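(* Let $\mathcal{D}$ be a Krull-Schmidt, left homologically finite triangulated category over a finite field $k$, and let $\sigma=(Z,\mathcal{P})$ be a stability condition on $\mathcal{D}$. Let $\gamma\in K_0(\mathcal{D})$. Then $$\kappa_\gamma=\sum_{\substack{\gamma_1+\gamma_2+\dots+\gamma_n=\gamma\\ \phi_{m_1}(\gamma_1)>\phi_{m_2}(\gamma_2)>\dots>\phi_{m_n}(\gamma_n)}}{}^{m_1}\delta^\sigma_{\gamma_1}*{}^{m_2}\delta^\sigma_{\gamma_2}*\dots*{}^{m_n}\delta^\sigma_{\gamma_n},$$ where the sum is over all $n\geqslant 1$ and all pairs $(\gamma_i,m_i)$ with $\gamma_i\in K_0(\mathcal{D})\setminus\{0\}$, $m_i\in\mathbb{Z}$, satisfying the displayed conditions; and, for every $m\in\mathbb{Z}$, $${}^{m}\kappa^\sigma_\gamma=\sum_{\substack{\gamma_1+\gamma_2+\dots+\gamma_n=\gamma,\ m_n=m\\ \phi_{m_1}(\gamma_1)>\phi_{m_2}(\gamma_2)>\dots>\phi_{m_n}(\gamma_n)}}{}^{m_1}\delta^\sigma_{\gamma_1}*{}^{m_2}\delta^\sigma_{\gamma_2}*\dots*{}^{m_n}\delta^\sigma_{\gamma_n}.$$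
   Context: Left homologically finite: $\sum_{i\geqslant 0}\dim_k\mathrm{Hom}_{\mathcal{D}}(X[i],Y)<+\infty$ for all $X,Y\in\mathcal{D}$. For $M\in\mathcal{D}$, $\underline{\dim}\,M$ denotes the class of $M$ in the Grothendieck group $K_0(\mathcal{D})$. Derived Hall algebra: $\mathcal{H}(\mathcal{D})$ is the $\mathbb{Q}$-vector space with basis $u_{[M]}$ indexed by isomorphism classes of objects of $\mathcal{D}$, with associative product $u_{[M]}*u_{[N]}=\sum_{[L]}F^L_{MN}u_{[L]}$ and unit $u_{[0]}$, where $$F_{MN}^L=\frac{|(L,N)_{M[1]}|}{|\mathrm{Aut}\,N|}\cdot\frac{\{L,N\}}{\{N,N\}},\quad (L,N)_{M[1]}=\{f\in\mathrm{Hom}_{\mathcal{D}}(L,N)\mid \mathrm{cone} f\cong M[1]\},\quad \{L,N\}=\prod_{i>0}|\mathrm{Hom}_{\mathcal{D}}(L[i],N)|^{(-1)^i}.$$ Elements are viewed as functions on isomorphism classes ($f(M)$ is the coefficient of $u_{[M]}$); identities between possibly infinite sums and products are identities of such functions, with $*$ extended bilinearly and evaluated at each isomorphism class. Stability condition: a pair $\sigma=(Z,\mathcal{P})$ with $Z:K_0(\mathcal{D})\to\mathbb{C}$ a group homomorphism and $\mathcal{P}(\phi)$ ($\phi\in\mathbb{R}$) full additive extension-closed subcategories of $\mathcal{D}$ such that (1) a nonzero $M\in\mathcal{P}(\phi)$ has $Z(M)=m_Me^{i\pi\phi}$ with $m_M>0$; (2) $\mathcal{P}(\phi+1)=\mathcal{P}(\phi)[1]$;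 (3) $\mathrm{Hom}_{\mathcal{D}}(A_1,A_2)=0$ for $A_i\in\mathcal{P}(\phi_i)$, $\phi_1>\phi_2$; (4) every $0\neq M$ has a Harder-Narasimhan (HN) filtration: triangles $M_{i-1}\to M_i\to A_i\to M_{i-1}[1]$, $1\leqslant i\leqslant n$, $M_0=0$, $M_n=M$, with $0\neq A_i\in\mathcal{P}(\phi_i)$ and $\phi_1>\dots>\phi_n$ (unique up to isomorphism). Put $\phi^+(M)=\phi_1$, $\phi^-(M)=\phi_n$. A nonzero $M$ is $\sigma$-semistable of phase $\phi(M)=\phi$ if $M\in\mathcal{P}(\phi)$. For $\gamma\in K_0(\mathcal{D})$, $\kappa_\gamma$ is the characteristic function of $\{0\neq M\mid\underline{\dim}\,M=\gamma\}$. For $m\in\mathbb{Z}$, ${}^{m}\kappa^\sigma_\gamma$ is the characteristic function of $\{0\neq M\mid\underline{\dim}\,M=\gamma,\ \phi^-(M)\in(2m-1,2m+1]\}$, and ${}^{m}\delta^\sigma_\gamma$ (for $\gamma\neq0$) is the characteristic function of $\{0\neq M\mid M\ \sigma\text{-semistable},\ \underline{\dim}\,M=\gamma,\ \phi(M)\in(2m-1,2m+1]\}$. For $\gamma$ with $Z(\gamma)\neq0$ and $m\in\mathbb{Z}$, $\phi_m(\gamma)$ is the unique real number $\phi\in(2m-1,2m+1]$ such that $Z(\gamma)\in\mathbb{R}_{>0}e^{i\pi\phi}$. (If $Z(\gamma)=0$ then ${}^{m}\delta^\sigma_\gamma=0$; sums run only over tuples for which all $\phi_{m_i}(\gamma_i)$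 are defined.) *)

theory Defs
  imports
    Complex_Main
    "HOL-Library.Groups_Big_Fun"
    "HOL-Library.Indicator_Function"
    "HOL-Algebra.Ideal"
    "HOL-Algebra.Free_Abelian_Groups"
    "Jordan_Normal_Form.Missing_VectorSpace"
begin

section \<open>Triangulated categories linear over a field\<close>

text \<open>
  The morphisms \<open>X \<rightarrow> Y\<close> form the carrier of the module \<open>Hom D X Y\<close>; the inherited fields
  \<^const>\<open>monoid.mult\<close> and \<^const>\<open>monoid.one\<close> of that record carry no information.  Different Hom
  modules may share elements, so every operation on morphisms also takes the objects involved:
  \<open>cmp D X Y Z g f\<close> is the composite \<open>g \<circ> f\<close> of \<open>f : X \<rightarrow> Y\<close> and \<open>g : Y \<rightarrow> Z\<close>.
  The shift \<open>[1]\<close> is \<open>shf D\<close> on objects and \<open>shm D X Y\<close> on morphisms \<open>X \<rightarrow> Y\<close>, and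
  \<open>(X, Y, Z, u, v, w) \<in> tri D\<close> says that \<open>X \<rightarrow> Y \<rightarrow> Z \<rightarrow> X[1]\<close> with morphisms \<open>u, v, w\<close> is a
  distinguished triangle.
\<close>

record ('o, 'm, 'k) tricat =
  ob :: "'o set"
  Hom :: "'o \<Rightarrow> 'o \<Rightarrow> ('k, 'm) module"
  ide :: "'o \<Rightarrow> 'm"
  cmp :: "'o \<Rightarrow> 'o \<Rightarrow> 'o \<Rightarrow> 'm \<Rightarrow> 'm \<Rightarrow> 'm"
  shf :: "'o \<Rightarrow> 'o"
  shm :: "'o \<Rightarrow> 'o \<Rightarrow> 'm \<Rightarrow> 'm"
  tri :: "('o \<times> 'o \<times> 'o \<times> 'm \<times> 'm \<times> 'm) set"

abbreviation Mor :: "('o, 'm, 'k, 'z) tricat_scheme \<Rightarrow> 'o \<Rightarrow> 'o \<Rightarrow> 'm set"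
  where "Mor D X Y \<equiv> carrier (Hom D X Y)"

abbreviation shfn :: "('o, 'm, 'k, 'z) tricat_scheme \<Rightarrow> nat \<Rightarrow> 'o \<Rightarrow> 'o"
  where "shfn D i X \<equiv> (shf D ^^ i) X"

definition is_iso :: "('o, 'm, 'k, 'z) tricat_scheme \<Rightarrow> 'o \<Rightarrow> 'o \<Rightarrow> 'm \<Rightarrow> bool" where
  "is_iso D X Y f \<longleftrightarrow> f \<in> Mor D X Y \<and>
     (\<exists>g\<in>Mor D Y X. cmp D X Y X g f = ide D X \<and> cmp D Y X Y f g = ide D Y)"

definition isomorphic :: "('o, 'm, 'k, 'z) tricat_scheme \<Rightarrow> 'o \<Rightarrow> 'o \<Rightarrow> bool" where
  "isomorphic D X Y \<longleftrightarrow> (\<exists>f. is_iso D X Y f)"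

definition zero_object :: "('o, 'm, 'k, 'z) tricat_scheme \<Rightarrow> 'o \<Rightarrow> bool" where
  "zero_object D X \<longleftrightarrow> X \<in> ob D \<and>
     (\<forall>Y\<in>ob D. Mor D X Y = {\<zero>\<^bsub>Hom D X Y\<^esub>} \<and> Mor D Y X = {\<zero>\<^bsub>Hom D Y X\<^esub>})"

text \<open>\<open>X\<close> is a direct sum (biproduct) of \<open>Y 0, \<dots>, Y (n - 1)\<close>; for \<open>n = 0\<close> this says that
  \<open>X\<close> is a zero object.\<close>

definition is_direct_sum ::
    "('o, 'm, 'k, 'z) tricat_scheme \<Rightarrow> nat \<Rightarrow> (nat \<Rightarrow> 'o) \<Rightarrow> 'o \<Rightarrow> bool" where
  "is_direct_sum D n Y X \<longleftrightarrow> X \<in> ob D \<and> (\<forall>i<n. Y i \<in> ob D) \<and>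
     (\<exists>\<iota> \<pi>. (\<forall>i<n. \<iota> i \<in> Mor D (Y i) X \<and> \<pi> i \<in> Mor D X (Y i)) \<and>
        (\<forall>i<n. \<forall>j<n. cmp D (Y j) X (Y i) (\<pi> i) (\<iota> j) =
            (if i = j then ide D (Y i) else \<zero>\<^bsub>Hom D (Y j) (Y i)\<^esub>)) \<and>
        (\<Oplus>\<^bsub>Hom D X X\<^esub>i\<in>{..<n}. cmp D X (Y i) X (\<iota> i) (\<pi> i)) = ide D X)"

locale linear_category = field K
  for K :: "('k, 'r) ring_scheme" and D :: "('o, 'm, 'k, 'z) tricat_scheme" +
  assumes Hom_module: "\<lbrakk>X \<in> ob D; Y \<in> ob D\<rbrakk> \<Longrightarrow> Module.module K (Hom D X Y)"
    and ide_closed: "X \<in> ob D \<Longrightarrow> ide D X \<in> Mor D X X"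
    and cmp_closed: "\<lbrakk>X \<in> ob D; Y \<in> ob D; Z \<in> ob D; f \<in> Mor D X Y; g \<in> Mor D Y Z\<rbrakk>
      \<Longrightarrow> cmp D X Y Z g f \<in> Mor D X Z"
    and cmp_ide_right: "\<lbrakk>X \<in> ob D; Y \<in> ob D; f \<in> Mor D X Y\<rbrakk> \<Longrightarrow> cmp D X X Y f (ide D X) = f"
    and cmp_ide_left: "\<lbrakk>X \<in> ob D; Y \<in> ob D; f \<in> Mor D X Y\<rbrakk> \<Longrightarrow> cmp D X Y Y (ide D Y) f = f"
    and cmp_assoc: "\<lbrakk>W \<in> ob D; X \<in> ob D; Y \<in> ob D; Z \<in> ob D;
        f \<in> Mor D W X; g \<in> Mor D X Y; h \<in> Mor D Y Z\<rbrakk>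
      \<Longrightarrow> cmp D W X Z (cmp D X Y Z h g) f = cmp D W Y Z h (cmp D W X Y g f)"
    and cmp_add_left: "\<lbrakk>X \<in> ob D; Y \<in> ob D; Z \<in> ob D;
        f \<in> Mor D X Y; g \<in> Mor D Y Z; h \<in> Mor D Y Z\<rbrakk>
      \<Longrightarrow> cmp D X Y Z (g \<oplus>\<^bsub>Hom D Y Z\<^esub> h) f = cmp D X Y Z g f \<oplus>\<^bsub>Hom D X Z\<^esub> cmp D X Y Z h f"
    and cmp_add_right: "\<lbrakk>X \<in> ob D; Y \<in> ob D; Z \<in> ob D;
        f \<in> Mor D X Y; h \<in> Mor D X Y; g \<in> Mor D Y Z\<rbrakk>
      \<Longrightarrow> cmp D X Y Z g (f \<oplus>\<^bsub>Hom D X Y\<^esub> h) = cmp D X Y Z g f \<oplus>\<^bsub>Hom D X Z\<^esub> cmp D X Y Z g h"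
    and cmp_smult_left: "\<lbrakk>X \<in> ob D; Y \<in> ob D; Z \<in> ob D; a \<in> carrier K;
        f \<in> Mor D X Y; g \<in> Mor D Y Z\<rbrakk>
      \<Longrightarrow> cmp D X Y Z (a \<odot>\<^bsub>Hom D Y Z\<^esub> g) f = a \<odot>\<^bsub>Hom D X Z\<^esub> cmp D X Y Z g f"
    and cmp_smult_right: "\<lbrakk>X \<in> ob D; Y \<in> ob D; Z \<in> ob D; a \<in> carrier K;
        f \<in> Mor D X Y; g \<in> Mor D Y Z\<rbrakk>
      \<Longrightarrow> cmp D X Y Z g (a \<odot>\<^bsub>Hom D X Y\<^esub> f) = a \<odot>\<^bsub>Hom D X Z\<^esub> cmp D X Y Z g f"

locale additive_linear_category = linear_category +
  assumes direct_sums_exist: "(\<And>i. i < n \<Longrightarrow> Y i \<in> ob D) \<Longrightarrow> \<exists>X\<in>ob D. is_direct_sum D n Y X"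

text \<open>The shift is only required to be a linear autoequivalence, not an automorphism.\<close>

locale shift_category = additive_linear_category +
  assumes shf_closed: "X \<in> ob D \<Longrightarrow> shf D X \<in> ob D"
    and shm_fully_faithful: "\<lbrakk>X \<in> ob D; Y \<in> ob D\<rbrakk>
      \<Longrightarrow> bij_betw (shm D X Y) (Mor D X Y) (Mor D (shf D X) (shf D Y))"
    and shf_ess_surj: "Y \<in> ob D \<Longrightarrow> \<exists>X\<in>ob D. isomorphic D (shf D X) Y"
    and shm_ide: "X \<in> ob D \<Longrightarrow> shm D X X (ide D X) = ide D (shf D X)"
    and shm_cmp: "\<lbrakk>X \<in> ob D; Y \<in> ob D; Z \<in> ob D; f \<in> Mor D X Y; g \<in> Mor D Y Z\<rbrakk>
      \<Longrightarrow> shm D X Z (cmp D X Y Z g f) =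
          cmp D (shf D X) (shf D Y) (shf D Z) (shm D Y Z g) (shm D X Y f)"
    and shm_add: "\<lbrakk>X \<in> ob D; Y \<in> ob D; f \<in> Mor D X Y; g \<in> Mor D X Y\<rbrakk>
      \<Longrightarrow> shm D X Y (f \<oplus>\<^bsub>Hom D X Y\<^esub> g) =
          shm D X Y f \<oplus>\<^bsub>Hom D (shf D X) (shf D Y)\<^esub> shm D X Y g"
    and shm_smult: "\<lbrakk>X \<in> ob D; Y \<in> ob D; a \<in> carrier K; f \<in> Mor D X Y\<rbrakk>
      \<Longrightarrow> shm D X Y (a \<odot>\<^bsub>Hom D X Y\<^esub> f) = a \<odot>\<^bsub>Hom D (shf D X) (shf D Y)\<^esub> shm D X Y f"

definition is_triangle :: "('o, 'm, 'k, 'z) tricat_scheme \<Rightarrow>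
    'o \<Rightarrow> 'o \<Rightarrow> 'o \<Rightarrow> 'm \<Rightarrow> 'm \<Rightarrow> 'm \<Rightarrow> bool" where
  "is_triangle D X Y Z u v w \<longleftrightarrow> X \<in> ob D \<and> Y \<in> ob D \<and> Z \<in> ob D \<and>
     u \<in> Mor D X Y \<and> v \<in> Mor D Y Z \<and> w \<in> Mor D Z (shf D X)"

definition triangle_morphism :: "('o, 'm, 'k, 'z) tricat_scheme \<Rightarrow>
    'o \<Rightarrow> 'o \<Rightarrow> 'o \<Rightarrow> 'm \<Rightarrow> 'm \<Rightarrow> 'm \<Rightarrow> 'o \<Rightarrow> 'o \<Rightarrow> 'o \<Rightarrow> 'm \<Rightarrow> 'm \<Rightarrow> 'm \<Rightarrow> 'm \<Rightarrow> 'm \<Rightarrow> 'm \<Rightarrow> bool" where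
  "triangle_morphism D X Y Z u v w X' Y' Z' u' v' w' a b c \<longleftrightarrow>
     a \<in> Mor D X X' \<and> b \<in> Mor D Y Y' \<and> c \<in> Mor D Z Z' \<and>
     cmp D X Y Y' b u = cmp D X X' Y' u' a \<and>
     cmp D Y Z Z' c v = cmp D Y Y' Z' v' b \<and>
     cmp D Z (shf D X) (shf D X') (shm D X X' a) w = cmp D Z Z' (shf D X') w' c"

text \<open>
  In the octahedral axiom the three given triangles are
  \<open>X \<rightarrow>u Y \<rightarrow>j Z' \<rightarrow>k X[1]\<close>, \<open>Y \<rightarrow>v Z \<rightarrow>l X' \<rightarrow>i Y[1]\<close> and \<open>X \<rightarrow>vu Z \<rightarrow>m Y' \<rightarrow>n X[1]\<close>.
\<close>

locale triangulated_category = shift_category +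
  assumes tri_is_triangle: "(X, Y, Z, u, v, w) \<in> tri D \<Longrightarrow> is_triangle D X Y Z u v w"
    and tri_iso_closed: "\<lbrakk>(X, Y, Z, u, v, w) \<in> tri D; is_triangle D X' Y' Z' u' v' w';
        triangle_morphism D X Y Z u v w X' Y' Z' u' v' w' a b c;
        is_iso D X X' a; is_iso D Y Y' b; is_iso D Z Z' c\<rbrakk>
      \<Longrightarrow> (X', Y', Z', u', v', w') \<in> tri D"
    and tri_ide: "\<lbrakk>X \<in> ob D; zero_object D Z\<rbrakk>
      \<Longrightarrow> (X, X, Z, ide D X, \<zero>\<^bsub>Hom D X Z\<^esub>, \<zero>\<^bsub>Hom D Z (shf D X)\<^esub>) \<in> tri D"
    and tri_exists: "\<lbrakk>X \<in> ob D; Y \<in> ob D; u \<in> Mor D X Y\<rbrakk>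
      \<Longrightarrow> \<exists>Z v w. (X, Y, Z, u, v, w) \<in> tri D"
    and tri_rotate: "is_triangle D X Y Z u v w
      \<Longrightarrow> (X, Y, Z, u, v, w) \<in> tri D \<longleftrightarrow>
          (Y, Z, shf D X, v, w, \<ominus>\<^bsub>Hom D (shf D X) (shf D Y)\<^esub> shm D X Y u) \<in> tri D"
    and tri_fill: "\<lbrakk>(X, Y, Z, u, v, w) \<in> tri D; (X', Y', Z', u', v', w') \<in> tri D;
        a \<in> Mor D X X'; b \<in> Mor D Y Y'; cmp D X Y Y' b u = cmp D X X' Y' u' a\<rbrakk>
      \<Longrightarrow> \<exists>c. triangle_morphism D X Y Z u v w X' Y' Z' u' v' w' a b c"
    and tri_octahedral: "\<lbrakk>(X, Y, Z', u, j, k) \<in> tri D; (Y, Z, X', v, l, i) \<in> tri D;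
        (X, Z, Y', cmp D X Y Z v u, m, n) \<in> tri D\<rbrakk>
      \<Longrightarrow> \<exists>f g. (Z', Y', X', f, g, cmp D X' (shf D Y) (shf D Z') (shm D Y Z' j) i) \<in> tri D \<and>
            triangle_morphism D X Y Z' u j k X Z Y' (cmp D X Y Z v u) m n (ide D X) v f \<and>
            triangle_morphism D X Z Y' (cmp D X Y Z v u) m n Y Z X' v l i u (ide D Z) g"


section \<open>Krull-Schmidt and homological finiteness\<close>

definition End_ring :: "('o, 'm, 'k, 'z) tricat_scheme \<Rightarrow> 'o \<Rightarrow> 'm ring" where
  "End_ring D X = \<lparr>carrier = Mor D X X, monoid.mult = cmp D X X X, monoid.one = ide D X,
     ring.zero = \<zero>\<^bsub>Hom D X X\<^esub>, ring.add = ring.add (Hom D X X)\<rparr>"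

text \<open>Noncommutative local rings: the non-units form a two-sided ideal.  This excludes the zero
  ring, whose only element is a unit.\<close>

definition local_ring :: "('a, 'b) ring_scheme \<Rightarrow> bool" where
  "local_ring R \<longleftrightarrow> ring R \<and> ideal (carrier R - Units R) R"

definition krull_schmidt :: "('o, 'm, 'k, 'z) tricat_scheme \<Rightarrow> bool" where
  "krull_schmidt D \<longleftrightarrow> (\<forall>X\<in>ob D. \<exists>n Y. is_direct_sum D n Y X \<and> (\<forall>i<n. local_ring (End_ring D (Y i))))"

definition left_homologically_finite ::
    "('k, 'r) ring_scheme \<Rightarrow> ('o, 'm, 'k, 'z) tricat_scheme \<Rightarrow> bool" where
  "left_homologically_finite K D \<longleftrightarrow> (\<forall>X\<in>ob D. \<forall>Y\<in>ob D.
     (\<forall>i. vectorspace.fin_dim K (Hom D (shfn D i X) Y)) \<and>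
     summable (\<lambda>i. real (vectorspace.dim K (Hom D (shfn D i X) Y))))"


section \<open>The Grothendieck group\<close>

definition k0_relations :: "('o, 'm, 'k, 'z) tricat_scheme \<Rightarrow> ('o \<Rightarrow>\<^sub>0 int) set" where
  "k0_relations D = {frag_of Y - frag_of X - frag_of Z | X Y Z u v w. (X, Y, Z, u, v, w) \<in> tri D}"

definition k0_subgroup :: "('o, 'm, 'k, 'z) tricat_scheme \<Rightarrow> ('o \<Rightarrow>\<^sub>0 int) set" where
  "k0_subgroup D = generate (free_Abelian_group (ob D)) (k0_relations D)"

text \<open>The group is written multiplicatively, so \<open>\<gamma> \<noteq> 0\<close> reads \<open>\<gamma> \<noteq> \<one>\<^bsub>K0 D\<^esub>\<close>.\<close>

definition K0 :: "('o, 'm, 'k, 'z) tricat_scheme \<Rightarrow> ('o \<Rightarrow>\<^sub>0 int) set monoid" where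
  "K0 D = free_Abelian_group (ob D) Mod k0_subgroup D"

definition k0_class :: "('o, 'm, 'k, 'z) tricat_scheme \<Rightarrow> 'o \<Rightarrow> ('o \<Rightarrow>\<^sub>0 int) set" where
  "k0_class D M = k0_subgroup D #>\<^bsub>free_Abelian_group (ob D)\<^esub> frag_of M"


section \<open>The derived Hall algebra\<close>

definition iso_rel :: "('o, 'm, 'k, 'z) tricat_scheme \<Rightarrow> 'o rel" where
  "iso_rel D = {(X, Y). X \<in> ob D \<and> Y \<in> ob D \<and> isomorphic D X Y}"

definition iso_class :: "('o, 'm, 'k, 'z) tricat_scheme \<Rightarrow> 'o \<Rightarrow> 'o set" where
  "iso_class D X = iso_rel D `` {X}"

definition iso_classes :: "('o, 'm, 'k, 'z) tricat_scheme \<Rightarrow> 'o set set" where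
  "iso_classes D = ob D // iso_rel D"

definition Hom_with_cone :: "('o, 'm, 'k, 'z) tricat_scheme \<Rightarrow> 'o \<Rightarrow> 'o \<Rightarrow> 'o \<Rightarrow> 'm set" where
  "Hom_with_cone D L N W =
     {f \<in> Mor D L N. \<exists>C g h. (L, N, C, f, g, h) \<in> tri D \<and> isomorphic D C W}"

definition Aut :: "('o, 'm, 'k, 'z) tricat_scheme \<Rightarrow> 'o \<Rightarrow> 'm set" where
  "Aut D X = {f. is_iso D X X f}"

text \<open>\<open>{L,N}\<close>, with the factors \<open>i > 0\<close> indexed by \<open>Suc i\<close>.  Only finitely many factors differ from
  \<open>1\<close> under left homological finiteness.\<close>

definition hom_euler :: "('o, 'm, 'k, 'z) tricat_scheme \<Rightarrow> 'o \<Rightarrow> 'o \<Rightarrow> rat" where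
  "hom_euler D L N = (\<Prod>i. of_nat (card (Mor D (shfn D (Suc i) L) N)) powi ((- 1) ^ Suc i))"

definition hall_number :: "('o, 'm, 'k, 'z) tricat_scheme \<Rightarrow> 'o \<Rightarrow> 'o \<Rightarrow> 'o \<Rightarrow> rat" where
  "hall_number D M N L =
     of_nat (card (Hom_with_cone D L N (shf D M))) / of_nat (card (Aut D N)) *
     (hom_euler D L N / hom_euler D N N)"

text \<open>
  Functions on isomorphism classes have type \<^typ>\<open>'o set \<Rightarrow> rat\<close>; structure constants are evaluated
  at representatives of the classes.  In \<open>(f * g)(L)\<close> the sum runs over all pairs of isomorphism
  classes and is meaningful when only finitely many terms are nonzero, which is what
  \<open>hall_mult_defined\<close> records.
\<close>

definition iso_rep :: "'o set \<Rightarrow> 'o" where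
  "iso_rep C = (SOME X. X \<in> C)"

definition hall_term :: "('o, 'm, 'k, 'z) tricat_scheme \<Rightarrow> ('o set \<Rightarrow> rat) \<Rightarrow> ('o set \<Rightarrow> rat) \<Rightarrow>
    'o set \<Rightarrow> 'o set \<times> 'o set \<Rightarrow> rat" where
  "hall_term D f g L = (\<lambda>(M, N). f M * g N * hall_number D (iso_rep M) (iso_rep N) (iso_rep L))"

definition hall_support :: "('o, 'm, 'k, 'z) tricat_scheme \<Rightarrow> ('o set \<Rightarrow> rat) \<Rightarrow> ('o set \<Rightarrow> rat) \<Rightarrow>
    'o set \<Rightarrow> ('o set \<times> 'o set) set" where
  "hall_support D f g L = {p \<in> iso_classes D \<times> iso_classes D. hall_term D f g L p \<noteq> 0}"

definition hall_mult :: "('o, 'm, 'k, 'z) tricat_scheme \<Rightarrow> ('o set \<Rightarrow> rat) \<Rightarrow> ('o set \<Rightarrow> rat) \<Rightarrow>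
    'o set \<Rightarrow> rat" where
  "hall_mult D f g L = (\<Sum>p\<in>hall_support D f g L. hall_term D f g L p)"

lemma hall_mult_basis:
  assumes "M \<in> iso_classes D" "N \<in> iso_classes D"
  shows "hall_mult D (indicator {M}) (indicator {N}) L =
    hall_number D (iso_rep M) (iso_rep N) (iso_rep L)"
proof -
  let ?h = "hall_number D (iso_rep M) (iso_rep N) (iso_rep L)"
  have "hall_support D (indicator {M}) (indicator {N}) L = (if ?h = 0 then {} else {(M, N)})"
    using assms by (auto simp: hall_support_def hall_term_def indicator_def split: if_splits)
  then show ?thesis
    by (simp add: hall_mult_def hall_term_def)
qed

definition hall_mult_defined :: "('o, 'm, 'k, 'z) tricat_scheme \<Rightarrow> ('o set \<Rightarrow> rat) \<Rightarrow>
    ('o set \<Rightarrow> rat) \<Rightarrow> bool" where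
  "hall_mult_defined D f g \<longleftrightarrow> (\<forall>L\<in>iso_classes D. finite (hall_support D f g L))"

text \<open>Products of nonempty lists, bracketed to the left: \<open>(\<dots>((f\<^sub>1 * f\<^sub>2) * f\<^sub>3) * \<dots>) * f\<^sub>n\<close>.\<close>

definition hall_prod :: "('o, 'm, 'k, 'z) tricat_scheme \<Rightarrow> ('o set \<Rightarrow> rat) list \<Rightarrow> 'o set \<Rightarrow> rat" where
  "hall_prod D fs = foldl (hall_mult D) (hd fs) (tl fs)"

definition hall_prod_defined :: "('o, 'm, 'k, 'z) tricat_scheme \<Rightarrow> ('o set \<Rightarrow> rat) list \<Rightarrow> bool" where
  "hall_prod_defined D fs \<longleftrightarrow>
     (\<forall>i. 0 < i \<and> i < length fs \<longrightarrow> hall_mult_defined D (hall_prod D (take i fs)) (fs ! i))"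

text \<open>A sum with possibly infinite index set all but finitely many of whose terms vanish.\<close>

definition has_finite_sum :: "('a \<Rightarrow> rat) \<Rightarrow> 'a set \<Rightarrow> rat \<Rightarrow> bool" where
  "has_finite_sum f A s \<longleftrightarrow> finite {x \<in> A. f x \<noteq> 0} \<and> (\<Sum>x\<in>{x \<in> A. f x \<noteq> 0}. f x) = s"


section \<open>Stability conditions\<close>

definition additive_subcategory :: "('o, 'm, 'k, 'z) tricat_scheme \<Rightarrow> 'o set \<Rightarrow> bool" where
  "additive_subcategory D S \<longleftrightarrow> S \<subseteq> ob D \<and>
     (\<forall>n Y X. (\<forall>i<n. Y i \<in> S) \<longrightarrow> is_direct_sum D n Y X \<longrightarrow> X \<in> S)"

definition extension_closed :: "('o, 'm, 'k, 'z) tricat_scheme \<Rightarrow> 'o set \<Rightarrow> bool" where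
  "extension_closed D S \<longleftrightarrow>
     (\<forall>X Y Z u v w. (X, Y, Z, u, v, w) \<in> tri D \<longrightarrow> X \<in> S \<longrightarrow> Z \<in> S \<longrightarrow> Y \<in> S)"

text \<open>Filtration \<open>0 = E 0 \<rightarrow> E 1 \<rightarrow> \<dots> \<rightarrow> E n = M\<close> with factors \<open>A 1, \<dots>, A n\<close> of phases
  \<open>\<phi> 1 > \<dots> > \<phi> n\<close>.\<close>

definition HN_filtration :: "('o, 'm, 'k, 'z) tricat_scheme \<Rightarrow> (real \<Rightarrow> 'o set) \<Rightarrow> 'o \<Rightarrow> nat \<Rightarrow>
    (nat \<Rightarrow> 'o) \<Rightarrow> (nat \<Rightarrow> 'o) \<Rightarrow> (nat \<Rightarrow> real) \<Rightarrow> bool" where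
  "HN_filtration D P M n E A \<phi> \<longleftrightarrow> 1 \<le> n \<and> zero_object D (E 0) \<and> E n = M \<and>
     (\<forall>i\<in>{1..n}. (\<exists>u v w. (E (i - 1), E i, A i, u, v, w) \<in> tri D) \<and>
        \<not> zero_object D (A i) \<and> A i \<in> P (\<phi> i)) \<and>
     (\<forall>i\<in>{1..n}. \<forall>j\<in>{1..n}. i < j \<longrightarrow> \<phi> i > \<phi> j)"

definition complex_add_group :: "complex monoid" where
  "complex_add_group = \<lparr>carrier = UNIV, monoid.mult = (+), monoid.one = 0\<rparr>"

text \<open>A full subcategory is given by its set of objects.  In the condition on \<open>\<P>(\<phi> + 1)\<close>, the
  subcategory \<open>\<P>(\<phi>)[1]\<close> is closed under isomorphism, as the shift need not be
  bijective on objects.\<close>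

definition stability_condition :: "('o, 'm, 'k, 'z) tricat_scheme \<Rightarrow>
    (('o \<Rightarrow>\<^sub>0 int) set \<Rightarrow> complex) \<Rightarrow> (real \<Rightarrow> 'o set) \<Rightarrow> bool" where
  "stability_condition D Z P \<longleftrightarrow>
     Z \<in> hom (K0 D) complex_add_group \<and>
     (\<forall>\<phi>. additive_subcategory D (P \<phi>) \<and> extension_closed D (P \<phi>)) \<and>
     (\<forall>\<phi>. \<forall>M\<in>P \<phi>. \<not> zero_object D M \<longrightarrow>
        (\<exists>r>0. Z (k0_class D M) = complex_of_real r * exp (\<i> * complex_of_real (pi * \<phi>)))) \<and>
     (\<forall>\<phi>. P (\<phi> + 1) = {X \<in> ob D. \<exists>Y\<in>P \<phi>. isomorphic D X (shf D Y)}) \<and>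
     (\<forall>\<phi>\<^sub>1 \<phi>\<^sub>2. \<phi>\<^sub>1 > \<phi>\<^sub>2 \<longrightarrow>
        (\<forall>A\<^sub>1\<in>P \<phi>\<^sub>1. \<forall>A\<^sub>2\<in>P \<phi>\<^sub>2. Mor D A\<^sub>1 A\<^sub>2 = {\<zero>\<^bsub>Hom D A\<^sub>1 A\<^sub>2\<^esub>})) \<and>
     (\<forall>M\<in>ob D. \<not> zero_object D M \<longrightarrow> (\<exists>n E A \<phi>. HN_filtration D P M n E A \<phi>))"

definition phi_minus :: "('o, 'm, 'k, 'z) tricat_scheme \<Rightarrow> (real \<Rightarrow> 'o set) \<Rightarrow> 'o \<Rightarrow> real" where
  "phi_minus D P M = (THE p. \<exists>n E A \<phi>. HN_filtration D P M n E A \<phi> \<and> p = \<phi> n)"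

definition semistable :: "('o, 'm, 'k, 'z) tricat_scheme \<Rightarrow> (real \<Rightarrow> 'o set) \<Rightarrow> 'o \<Rightarrow> bool" where
  "semistable D P M \<longleftrightarrow> M \<in> ob D \<and> \<not> zero_object D M \<and> (\<exists>\<phi>. M \<in> P \<phi>)"

definition phase :: "(real \<Rightarrow> 'o set) \<Rightarrow> 'o \<Rightarrow> real" where
  "phase P M = (THE \<phi>. M \<in> P \<phi>)"

definition phase_window :: "int \<Rightarrow> real set" where
  "phase_window m = {2 * real_of_int m - 1 <.. 2 * real_of_int m + 1}"

definition kappa :: "('o, 'm, 'k, 'z) tricat_scheme \<Rightarrow> ('o \<Rightarrow>\<^sub>0 int) set \<Rightarrow> 'o set \<Rightarrow> rat" where
  "kappa D \<gamma> = indicator {iso_class D M | M. M \<in> ob D \<and> \<not> zero_object D M \<and> k0_class D M = \<gamma>}"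

definition kappa_m :: "('o, 'm, 'k, 'z) tricat_scheme \<Rightarrow> (real \<Rightarrow> 'o set) \<Rightarrow> int \<Rightarrow>
    ('o \<Rightarrow>\<^sub>0 int) set \<Rightarrow> 'o set \<Rightarrow> rat" where
  "kappa_m D P m \<gamma> = indicator {iso_class D M | M. M \<in> ob D \<and> \<not> zero_object D M \<and>
     k0_class D M = \<gamma> \<and> phi_minus D P M \<in> phase_window m}"

definition delta_m :: "('o, 'm, 'k, 'z) tricat_scheme \<Rightarrow> (real \<Rightarrow> 'o set) \<Rightarrow> int \<Rightarrow>
    ('o \<Rightarrow>\<^sub>0 int) set \<Rightarrow> 'o set \<Rightarrow> rat" where
  "delta_m D P m \<gamma> = indicator {iso_class D M | M. semistable D P M \<and>
     k0_class D M = \<gamma> \<and> phase P M \<in> phase_window m}"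

text \<open>\<open>\<phi>\<^sub>m(\<gamma>)\<close>, meaningful only for \<open>Z \<gamma> \<noteq> 0\<close>.\<close>

definition phi_m :: "('g \<Rightarrow> complex) \<Rightarrow> int \<Rightarrow> 'g \<Rightarrow> real" where
  "phi_m Z m \<gamma> = (THE \<phi>. \<phi> \<in> phase_window m \<and>
     (\<exists>r>0. Z \<gamma> = complex_of_real r * exp (\<i> * complex_of_real (pi * \<phi>))))"

text \<open>The tuples \<open>((\<gamma>\<^sub>1, m\<^sub>1), \<dots>, (\<gamma>\<^sub>n, m\<^sub>n))\<close> indexing the sums.\<close>

definition hn_types :: "('o, 'm, 'k, 'z) tricat_scheme \<Rightarrow> (('o \<Rightarrow>\<^sub>0 int) set \<Rightarrow> complex) \<Rightarrow>
    ('o \<Rightarrow>\<^sub>0 int) set \<Rightarrow> (('o \<Rightarrow>\<^sub>0 int) set \<times> int) list set" where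
  "hn_types D Z \<gamma> = {ts. ts \<noteq> [] \<and>
     (\<forall>(\<gamma>', m)\<in>set ts. \<gamma>' \<in> carrier (K0 D) \<and> \<gamma>' \<noteq> \<one>\<^bsub>K0 D\<^esub> \<and> Z \<gamma>' \<noteq> 0) \<and>
     foldr (\<otimes>\<^bsub>K0 D\<^esub>) (map fst ts) \<one>\<^bsub>K0 D\<^esub> = \<gamma> \<and>
     sorted_wrt (\<lambda>(\<gamma>\<^sub>1, m\<^sub>1) (\<gamma>\<^sub>2, m\<^sub>2). phi_m Z m\<^sub>1 \<gamma>\<^sub>1 > phi_m Z m\<^sub>2 \<gamma>\<^sub>2) ts}"

definition delta_list :: "('o, 'm, 'k, 'z) tricat_scheme \<Rightarrow> (real \<Rightarrow> 'o set) \<Rightarrow>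
    (('o \<Rightarrow>\<^sub>0 int) set \<times> int) list \<Rightarrow> ('o set \<Rightarrow> rat) list" where
  "delta_list D P ts = map (\<lambda>(\<gamma>, m). delta_m D P m \<gamma>) ts"

end

theory Submission
  imports Defs
begin

text \<open>
  The Harder-Narasimhan filtration of a nonzero object \<open>L\<close> is unique, and so is the list \<open>ts\<close> of the
  classes \<open>\<gamma>\<^sub>i\<close> and windows \<open>m\<^sub>i\<close> of its semistable factors, the type of \<open>L\<close>.  The idea is that a
  product \<open>\<delta>\<^sub>1 * \<dots> * \<delta>\<^sub>n\<close> over a list \<open>ts\<close> with decreasing phases is the characteristic
  function of the objects of type \<open>ts\<close>.  Summing over all lists of total class \<open>\<gamma>\<close> then counts every
  nonzero object of class \<open>\<gamma>\<close> exactly once, which is \<open>\<kappa>\<^sub>\<gamma>\<close>.  As \<open>\<phi>\<^sup>-(L)\<close> is the phase of the last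
  factor, the lists with \<open>m\<^sub>n = m\<close> select the objects counted by the second function.

  The product formula (\<open>hall_prod_delta_list\<close>) is proved by induction on \<open>n\<close>.  A nonzero term
  at \<open>L\<close> of \<open>(\<delta>\<^sub>1 * \<dots> * \<delta>\<^sub>n\<^sub>-\<^sub>1) * \<delta>\<^sub>n\<close> comes from a triangle \<open>M \<rightarrow> L \<rightarrow> N \<rightarrow> M[1]\<close> in which
  \<open>M\<close> has the shorter type and \<open>N\<close> is semistable of smaller phase.  Such a triangle is the last step of
  a filtration of \<open>L\<close>, hence \<open>M\<close> and \<open>N\<close> are determined by \<open>L\<close> up to isomorphism
  (\<open>hn_last_step_unique\<close>).  It remains to see that its Hall number is \<open>1\<close> (\<open>hall_number_eq\<close>).
  All phases of \<open>M[i]\<close>, \<open>i \<ge> 0\<close>, exceed that of \<open>N\<close>, so \<open>Hom(M[i], N) = 0\<close>.  By the long exact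
  sequence, composition with \<open>L \<rightarrow> N\<close> identifies \<open>Hom(N[i], N)\<close> with \<open>Hom(L[i], N)\<close> for all
  \<open>i \<ge> 0\<close>.  For \<open>i > 0\<close> this gives \<open>{L,N} = {N,N}\<close>.  For \<open>i = 0\<close> it shows that \<open>Aut N\<close> acts simply
  transitively on the morphisms \<open>L \<rightarrow> N\<close> with cone \<open>M[1]\<close>, so there are \<open>|Aut N|\<close> of them.

  Both uniqueness and the Hall number rest on one consequence of the axioms of a triangulated
  category (\<open>precomp_bij\<close>): in a triangle \<open>X \<rightarrow> Y \<rightarrow> Z \<rightarrow> X[1]\<close> with no maps from \<open>X\<close> and \<open>X[1]\<close> to
  \<open>N\<close>, every morphism \<open>Y \<rightarrow> N\<close> factors uniquely through \<open>Z\<close>.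
\<close>

section \<open>Composition with zero, differences and isomorphisms\<close>

context linear_category
begin

lemma Hom_abelian: "\<lbrakk>X \<in> ob D; Y \<in> ob D\<rbrakk> \<Longrightarrow> abelian_group (Hom D X Y)"
  using Hom_module module.axioms(2) by blast

lemma zero_closed [simp]: "\<lbrakk>X \<in> ob D; Y \<in> ob D\<rbrakk> \<Longrightarrow> \<zero>\<^bsub>Hom D X Y\<^esub> \<in> Mor D X Y"
  by (simp add: Hom_abelian abelian_monoid.zero_closed abelian_group.axioms(1))

lemma cmp_zero_left:
  assumes "X \<in> ob D" "Y \<in> ob D" "Z \<in> ob D" "f \<in> Mor D X Y"
  shows "cmp D X Y Z \<zero>\<^bsub>Hom D Y Z\<^esub> f = \<zero>\<^bsub>Hom D X Z\<^esub>"
proof -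
  interpret A: abelian_group "Hom D Y Z" using assms Hom_abelian by blast
  interpret B: abelian_group "Hom D X Z" using assms Hom_abelian by blast
  let ?x = "cmp D X Y Z \<zero>\<^bsub>Hom D Y Z\<^esub> f"
  have "?x \<oplus>\<^bsub>Hom D X Z\<^esub> ?x = ?x"
    using cmp_add_left[OF assms, of "\<zero>\<^bsub>Hom D Y Z\<^esub>" "\<zero>\<^bsub>Hom D Y Z\<^esub>"] by simp
  then show ?thesis
    using cmp_closed[OF assms(1-3)] assms(4) by simp
qed

lemma cmp_zero_right:
  assumes "X \<in> ob D" "Y \<in> ob D" "Z \<in> ob D" "g \<in> Mor D Y Z"
  shows "cmp D X Y Z g \<zero>\<^bsub>Hom D X Y\<^esub> = \<zero>\<^bsub>Hom D X Z\<^esub>"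
proof -
  interpret A: abelian_group "Hom D X Y" using assms Hom_abelian by blast
  interpret B: abelian_group "Hom D X Z" using assms Hom_abelian by blast
  let ?x = "cmp D X Y Z g \<zero>\<^bsub>Hom D X Y\<^esub>"
  have "?x \<oplus>\<^bsub>Hom D X Z\<^esub> ?x = ?x"
    using cmp_add_right[OF assms(1-3) A.zero_closed A.zero_closed assms(4)] by simp
  then show ?thesis
    using cmp_closed[OF assms(1-3)] assms(4) by simp
qed

lemma cmp_diff_left:
  assumes "X \<in> ob D" "Y \<in> ob D" "Z \<in> ob D" "f \<in> Mor D X Y" "g \<in> Mor D Y Z" "h \<in> Mor D Y Z"
  shows "cmp D X Y Z (g \<ominus>\<^bsub>Hom D Y Z\<^esub> h) f = cmp D X Y Z g f \<ominus>\<^bsub>Hom D X Z\<^esub> cmp D X Y Z h f"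
proof -
  interpret A: abelian_group "Hom D Y Z" using assms Hom_abelian by blast
  interpret B: abelian_group "Hom D X Z" using assms Hom_abelian by blast
  have d: "g \<ominus>\<^bsub>Hom D Y Z\<^esub> h \<in> Mor D Y Z" using assms by simp
  have "(g \<ominus>\<^bsub>Hom D Y Z\<^esub> h) \<oplus>\<^bsub>Hom D Y Z\<^esub> h = g"
    using assms by (simp add: A.minus_eq A.a_assoc A.l_neg)
  then have *: "cmp D X Y Z (g \<ominus>\<^bsub>Hom D Y Z\<^esub> h) f \<oplus>\<^bsub>Hom D X Z\<^esub> cmp D X Y Z h f = cmp D X Y Z g f"
    using cmp_add_left[OF assms(1-4) d assms(6)] by simp
  moreover have "cmp D X Y Z (g \<ominus>\<^bsub>Hom D Y Z\<^esub> h) f \<in> Mor D X Z" "cmp D X Y Z h f \<in> Mor D X Z"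
    using assms d cmp_closed by blast+
  ultimately show ?thesis
    unfolding *[symmetric] by (simp add: B.minus_eq B.a_assoc B.r_neg)
qed

lemma cmp_diff_right:
  assumes "X \<in> ob D" "Y \<in> ob D" "Z \<in> ob D" "f \<in> Mor D X Y" "h \<in> Mor D X Y" "g \<in> Mor D Y Z"
  shows "cmp D X Y Z g (f \<ominus>\<^bsub>Hom D X Y\<^esub> h) = cmp D X Y Z g f \<ominus>\<^bsub>Hom D X Z\<^esub> cmp D X Y Z g h"
proof -
  interpret A: abelian_group "Hom D X Y" using assms Hom_abelian by blast
  interpret B: abelian_group "Hom D X Z" using assms Hom_abelian by blast
  have d: "f \<ominus>\<^bsub>Hom D X Y\<^esub> h \<in> Mor D X Y" using assms by simp
  have "(f \<ominus>\<^bsub>Hom D X Y\<^esub> h) \<oplus>\<^bsub>Hom D X Y\<^esub> h = f"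
    using assms by (simp add: A.minus_eq A.a_assoc A.l_neg)
  then have *: "cmp D X Y Z g (f \<ominus>\<^bsub>Hom D X Y\<^esub> h) \<oplus>\<^bsub>Hom D X Z\<^esub> cmp D X Y Z g h = cmp D X Y Z g f"
    using cmp_add_right[OF assms(1-3) d assms(5,6)] by simp
  moreover have "cmp D X Y Z g (f \<ominus>\<^bsub>Hom D X Y\<^esub> h) \<in> Mor D X Z" "cmp D X Y Z g h \<in> Mor D X Z"
    using assms d cmp_closed by blast+
  ultimately show ?thesis
    unfolding *[symmetric] by (simp add: B.minus_eq B.a_assoc B.r_neg)
qed

lemma is_isoI:
  assumes "f \<in> Mor D X Y" "g \<in> Mor D Y X" "cmp D X Y X g f = ide D X" "cmp D Y X Y f g = ide D Y"
  shows "is_iso D X Y f"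
  using assms unfolding is_iso_def by blast

lemma is_iso_ide: "X \<in> ob D \<Longrightarrow> is_iso D X X (ide D X)"
  by (rule is_isoI[where g = "ide D X"]) (simp_all add: ide_closed cmp_ide_left)

lemma is_iso_cmp:
  assumes "X \<in> ob D" "Y \<in> ob D" "Z \<in> ob D" "is_iso D X Y f" "is_iso D Y Z g"
  shows "is_iso D X Z (cmp D X Y Z g f)"
proof -
  obtain f' where f: "f \<in> Mor D X Y" "f' \<in> Mor D Y X" "cmp D X Y X f' f = ide D X"
      "cmp D Y X Y f f' = ide D Y" using assms unfolding is_iso_def by blast
  obtain g' where g: "g \<in> Mor D Y Z" "g' \<in> Mor D Z Y" "cmp D Y Z Y g' g = ide D Y"
      "cmp D Z Y Z g g' = ide D Z" using assms unfolding is_iso_def by blast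
  note o = assms(1-3)
  show ?thesis
  proof (rule is_isoI[where g = "cmp D Z Y X f' g'"])
    show "cmp D X Y Z g f \<in> Mor D X Z" "cmp D Z Y X f' g' \<in> Mor D Z X"
      using o f g cmp_closed by blast+
    have "cmp D X Z X (cmp D Z Y X f' g') (cmp D X Y Z g f) =
        cmp D X Y X f' (cmp D X Z Y g' (cmp D X Y Z g f))"
      using o f g cmp_closed cmp_assoc by simp
    also have "cmp D X Z Y g' (cmp D X Y Z g f) = f"
      using o f g cmp_assoc[of X Y Z Y f g g'] cmp_ide_left by simp
    finally show "cmp D X Z X (cmp D Z Y X f' g') (cmp D X Y Z g f) = ide D X" using f by simp
    have "cmp D Z X Z (cmp D X Y Z g f) (cmp D Z Y X f' g') =
        cmp D Z Y Z g (cmp D Z X Y f (cmp D Z Y X f' g'))"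
      using o f g cmp_closed cmp_assoc by simp
    also have "cmp D Z X Y f (cmp D Z Y X f' g') = g'"
      using o f g cmp_assoc[of Z Y X Y g' f' f] cmp_ide_left by simp
    finally show "cmp D Z X Z (cmp D X Y Z g f) (cmp D Z Y X f' g') = ide D Z" using g by simp
  qed
qed

lemma iso_refl: "X \<in> ob D \<Longrightarrow> isomorphic D X X"
  using is_iso_ide unfolding isomorphic_def by blast

lemma iso_sym: "isomorphic D X Y \<Longrightarrow> isomorphic D Y X"
  unfolding isomorphic_def is_iso_def by blast

lemma iso_trans:
  "\<lbrakk>X \<in> ob D; Y \<in> ob D; Z \<in> ob D; isomorphic D X Y; isomorphic D Y Z\<rbrakk> \<Longrightarrow> isomorphic D X Z"
  using is_iso_cmp unfolding isomorphic_def by blast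

text \<open>An inverse of \<open>d c\<close> gives a left inverse of \<open>c\<close> and an inverse of \<open>c d\<close> gives a right
  inverse; the two then agree.\<close>

lemma is_iso_of_both_sides:
  assumes o: "X \<in> ob D" "Y \<in> ob D" and c: "c \<in> Mor D X Y" and d: "d \<in> Mor D Y X"
    and "is_iso D X X (cmp D X Y X d c)" "is_iso D Y Y (cmp D Y X Y c d)"
  shows "is_iso D X Y c"
proof -
  obtain a where a: "a \<in> Mor D X X" "cmp D X X X a (cmp D X Y X d c) = ide D X"
    using assms unfolding is_iso_def by blast
  obtain b where b: "b \<in> Mor D Y Y" "cmp D Y Y Y (cmp D Y X Y c d) b = ide D Y"
    using assms unfolding is_iso_def by blast
  let ?l = "cmp D Y X X a d" and ?r = "cmp D Y Y X d b"
  have l: "?l \<in> Mor D Y X" and r: "?r \<in> Mor D Y X" using o a b c d cmp_closed by blast+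
  have lc: "cmp D X Y X ?l c = ide D X" using a o c d cmp_assoc by simp
  have cr: "cmp D Y X Y c ?r = ide D Y" using b o c d cmp_assoc by simp
  have "?l = cmp D Y Y X ?l (cmp D Y X Y c ?r)" using cr o l cmp_ide_right by simp
  also have "\<dots> = ?r" using cmp_assoc[of Y X Y X ?r c ?l] lc o l r c cmp_ide_left by simp
  finally show ?thesis using is_isoI[OF c l lc] cr by simp
qed

text \<open>If \<open>e = h - 1\<close> has square zero then \<open>1 - e\<close> is inverse to \<open>h = 1 + e\<close>.\<close>

lemma unipotent_is_iso:
  assumes X: "X \<in> ob D" and h: "h \<in> Mor D X X"
    and e: "e = h \<ominus>\<^bsub>Hom D X X\<^esub> ide D X" and sq: "cmp D X X X e e = \<zero>\<^bsub>Hom D X X\<^esub>"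
  shows "is_iso D X X h"
proof -
  interpret A: abelian_group "Hom D X X" using X Hom_abelian by blast
  note i = ide_closed[OF X]
  have eX: "e \<in> Mor D X X" using e h i by simp
  have he: "h = e \<oplus>\<^bsub>Hom D X X\<^esub> ide D X" using e h i by (simp add: A.minus_eq A.a_assoc A.l_neg)
  let ?g = "ide D X \<ominus>\<^bsub>Hom D X X\<^esub> e"
  have g: "?g \<in> Mor D X X" using eX i by simp
  have he': "cmp D X X X h e = e"
    using X eX i he sq cmp_add_left[of X X X e e "ide D X"] cmp_ide_left by simp
  have eh': "cmp D X X X e h = e"
    using X eX i he sq cmp_add_right[of X X X e "ide D X" e] cmp_ide_right by simp
  have c: "h \<ominus>\<^bsub>Hom D X X\<^esub> e = ide D X"
    using he eX i by (simp add: A.minus_eq A.a_comm[of e] A.a_assoc A.r_neg)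
  have "cmp D X X X ?g h = ide D X"
    using X h i eX eh' c cmp_diff_left[of X X X h "ide D X" e] cmp_ide_left by simp
  moreover have "cmp D X X X h ?g = ide D X"
    using X h i eX he' c cmp_diff_right[of X X X "ide D X" e h] cmp_ide_right by simp
  ultimately show ?thesis using is_isoI[OF h g] by blast
qed

text \<open>Every morphism to or from \<open>X\<close> is its own composite with the identity of \<open>X\<close>.\<close>

lemma zero_objectI:
  assumes X: "X \<in> ob D" and "ide D X = \<zero>\<^bsub>Hom D X X\<^esub>"
  shows "zero_object D X"
proof -
  have "f = \<zero>\<^bsub>Hom D X Y\<^esub>" if "Y \<in> ob D" "f \<in> Mor D X Y" for f Y
    using cmp_ide_right[OF X that] cmp_zero_right[OF X X that] assms(2) by simp
  moreover have "f = \<zero>\<^bsub>Hom D Y X\<^esub>" if "Y \<in> ob D" "f \<in> Mor D Y X" for f Y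
    using cmp_ide_left[OF that(1) X that(2)] cmp_zero_left[OF that(1) X X that(2)] assms(2) by simp
  ultimately show ?thesis unfolding zero_object_def using X zero_closed by blast
qed

lemma zero_object_self: "zero_object D X \<Longrightarrow> ide D X = \<zero>\<^bsub>Hom D X X\<^esub>"
  unfolding zero_object_def using ide_closed by blast

lemma zero_object_if_Mor_self: "X \<in> ob D \<Longrightarrow> Mor D X X = {\<zero>\<^bsub>Hom D X X\<^esub>} \<Longrightarrow> zero_object D X"
  using zero_objectI ide_closed by blast

lemma zero_object_iso:
  assumes "zero_object D X" "Y \<in> ob D" "isomorphic D X Y"
  shows "zero_object D Y"
proof -
  obtain f g where fg: "f \<in> Mor D X Y" "g \<in> Mor D Y X" "cmp D Y X Y f g = ide D Y"
    using assms unfolding isomorphic_def is_iso_def by blast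
  have X: "X \<in> ob D" using assms by (simp add: zero_object_def)
  have "f = \<zero>\<^bsub>Hom D X Y\<^esub>" using assms fg X unfolding zero_object_def by blast
  then have "ide D Y = \<zero>\<^bsub>Hom D Y Y\<^esub>" using fg cmp_zero_left[OF assms(2) X assms(2) fg(2)] by simp
  then show ?thesis using assms zero_objectI by blast
qed

text \<open>Closure under isomorphism is the case of one summand in closure under direct sums.\<close>

lemma iso_is_direct_sum:
  assumes "X \<in> ob D" "Y \<in> ob D" "isomorphic D X Y"
  shows "is_direct_sum D 1 (\<lambda>_. X) Y"
proof -
  obtain f g where fg: "f \<in> Mor D X Y" "g \<in> Mor D Y X" "cmp D X Y X g f = ide D X"
      "cmp D Y X Y f g = ide D Y"
    using assms unfolding isomorphic_def is_iso_def by blast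
  interpret A: abelian_group "Hom D Y Y" using assms Hom_abelian by blast
  have "finsum (Hom D Y Y) (\<lambda>i. cmp D Y X Y f g) {..<1::nat} = ide D Y"
  proof -
    have "{..<1::nat} = {0}" by auto
    then show ?thesis using fg ide_closed assms(2) by simp
  qed
  then show ?thesis unfolding is_direct_sum_def using fg assms
    by (intro conjI exI[of _ "\<lambda>_. f"] exI[of _ "\<lambda>_. g"]) auto
qed

end

section \<open>The shift\<close>

context shift_category
begin

lemma shfn_closed: "X \<in> ob D \<Longrightarrow> shfn D i X \<in> ob D"
  by (induction i) (auto simp: shf_closed)

lemma shm_closed: "\<lbrakk>X \<in> ob D; Y \<in> ob D; f \<in> Mor D X Y\<rbrakk> \<Longrightarrow> shm D X Y f \<in> Mor D (shf D X) (shf D Y)"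
  using bij_betw_apply[OF shm_fully_faithful] by blast

lemma shm_zero:
  assumes "X \<in> ob D" "Y \<in> ob D"
  shows "shm D X Y \<zero>\<^bsub>Hom D X Y\<^esub> = \<zero>\<^bsub>Hom D (shf D X) (shf D Y)\<^esub>"
proof -
  interpret A: abelian_group "Hom D X Y" using assms Hom_abelian by blast
  interpret B: abelian_group "Hom D (shf D X) (shf D Y)" using assms shf_closed Hom_abelian by blast
  let ?x = "shm D X Y \<zero>\<^bsub>Hom D X Y\<^esub>"
  have "?x \<oplus>\<^bsub>Hom D (shf D X) (shf D Y)\<^esub> ?x = ?x"
    using shm_add[OF assms A.zero_closed A.zero_closed] by simp
  then show ?thesis
    using shm_closed[OF assms A.zero_closed] by simp
qed

lemma shf_zero_object: "zero_object D X \<Longrightarrow> zero_object D (shf D X)"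
proof -
  assume X: "zero_object D X"
  then have o: "X \<in> ob D" by (simp add: zero_object_def)
  have "ide D (shf D X) = \<zero>\<^bsub>Hom D (shf D X) (shf D X)\<^esub>"
    using shm_ide[OF o] shm_zero[OF o o] zero_object_self[OF X] by simp
  then show ?thesis using zero_objectI shf_closed[OF o] by blast
qed

lemma shfn_zero_object: "zero_object D X \<Longrightarrow> zero_object D (shfn D i X)"
  by (induction i) (auto simp: shf_zero_object)

lemma shf_iso:
  assumes "X \<in> ob D" "Y \<in> ob D" "isomorphic D X Y"
  shows "isomorphic D (shf D X) (shf D Y)"
proof -
  obtain f g where fg: "f \<in> Mor D X Y" "g \<in> Mor D Y X" "cmp D X Y X g f = ide D X"
      "cmp D Y X Y f g = ide D Y"
    using assms unfolding isomorphic_def is_iso_def by blast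
  have "is_iso D (shf D X) (shf D Y) (shm D X Y f)"
    by (rule is_isoI[where g = "shm D Y X g"])
       (use assms fg shm_closed shm_cmp[symmetric] shm_ide in simp_all)
  then show ?thesis unfolding isomorphic_def by blast
qed

lemma iso_of_shf_iso:
  assumes o: "X \<in> ob D" "Y \<in> ob D" and "isomorphic D (shf D X) (shf D Y)"
  shows "isomorphic D X Y"
proof -
  obtain f g where fg: "f \<in> Mor D (shf D X) (shf D Y)" "g \<in> Mor D (shf D Y) (shf D X)"
      "cmp D (shf D X) (shf D Y) (shf D X) g f = ide D (shf D X)"
      "cmp D (shf D Y) (shf D X) (shf D Y) f g = ide D (shf D Y)"
    using assms unfolding isomorphic_def is_iso_def by blast
  obtain a where a: "a \<in> Mor D X Y" "f = shm D X Y a"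
    using shm_fully_faithful[OF o] fg(1) unfolding bij_betw_def by blast
  obtain b where b: "b \<in> Mor D Y X" "g = shm D Y X b"
    using shm_fully_faithful[OF o(2,1)] fg(2) unfolding bij_betw_def by blast
  have "cmp D X Y X b a = ide D X"
  proof (rule inj_onD[OF bij_betw_imp_inj_on[OF shm_fully_faithful[OF o(1,1)]]])
    show "shm D X X (cmp D X Y X b a) = shm D X X (ide D X)"
      using o a b fg shm_cmp shm_ide by simp
  qed (use o a b cmp_closed ide_closed in auto)
  moreover have "cmp D Y X Y a b = ide D Y"
  proof (rule inj_onD[OF bij_betw_imp_inj_on[OF shm_fully_faithful[OF o(2,2)]]])
    show "shm D Y Y (cmp D Y X Y a b) = shm D Y Y (ide D Y)"
      using o a b fg shm_cmp shm_ide by simp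
  qed (use o a b cmp_closed ide_closed in auto)
  ultimately show ?thesis using is_isoI[OF a(1) b(1)] unfolding isomorphic_def by blast
qed

end

section \<open>Triangles and morphisms into a fixed object\<close>

definition no_maps :: "('o, 'm, 'k, 'z) tricat_scheme \<Rightarrow> 'o \<Rightarrow> 'o \<Rightarrow> bool" where
  "no_maps D X Y \<longleftrightarrow> Mor D X Y = {\<zero>\<^bsub>Hom D X Y\<^esub>}"

context triangulated_category
begin

lemma triangle_obs:
  assumes "(X, Y, Z, u, v, w) \<in> tri D"
  shows "X \<in> ob D" "Y \<in> ob D" "Z \<in> ob D" "u \<in> Mor D X Y" "v \<in> Mor D Y Z" "w \<in> Mor D Z (shf D X)"
  using tri_is_triangle[OF assms] unfolding is_triangle_def by auto

lemma rotate_triangle: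
  assumes "(X, Y, Z, u, v, w) \<in> tri D"
  shows "(Y, Z, shf D X, v, w, \<ominus>\<^bsub>Hom D (shf D X) (shf D Y)\<^esub> shm D X Y u) \<in> tri D"
  using tri_rotate[OF tri_is_triangle[OF assms]] assms by blast

text \<open>The shift is full, so up to a sign the third morphism of the rotated triangle is the shift of a
  morphism \<open>u\<close>.\<close>

lemma unrotate_triangle:
  assumes t: "(Y, Z, shf D X, v, w, u') \<in> tri D" and X: "X \<in> ob D"
  shows "\<exists>u. (X, Y, Z, u, v, w) \<in> tri D"
proof -
  note o = triangle_obs[OF t]
  interpret A: abelian_group "Hom D (shf D X) (shf D Y)" using X o shf_closed Hom_abelian by blast
  have "\<ominus>\<^bsub>Hom D (shf D X) (shf D Y)\<^esub> u' \<in> Mor D (shf D X) (shf D Y)" using o by simp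
  then have "\<ominus>\<^bsub>Hom D (shf D X) (shf D Y)\<^esub> u' \<in> shm D X Y ` Mor D X Y"
    using bij_betw_imp_surj_on[OF shm_fully_faithful[OF X o(1)]] by simp
  then obtain u where u: "\<ominus>\<^bsub>Hom D (shf D X) (shf D Y)\<^esub> u' = shm D X Y u" "u \<in> Mor D X Y"
    by (rule imageE)
  have "is_triangle D X Y Z u v w" using u o X unfolding is_triangle_def by simp
  from tri_rotate[OF this] show ?thesis using t u(1)[symmetric] o by auto
qed

text \<open>Three rotations shift a triangle, up to the signs of its morphisms.\<close>

lemma shift_triangle:
  assumes "(X, Y, Z, u, v, w) \<in> tri D"
  shows "\<exists>u v w. (shfn D i X, shfn D i Y, shfn D i Z, u, v, w) \<in> tri D"
proof (induction i)
  case 0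
  then show ?case using assms by auto
next
  case (Suc i)
  then obtain u v w where "(shfn D i X, shfn D i Y, shfn D i Z, u, v, w) \<in> tri D" by blast
  from rotate_triangle[OF rotate_triangle[OF rotate_triangle[OF this]]] show ?case by auto
qed

lemma zero_object_exists: "\<exists>T. zero_object D T"
proof -
  obtain T where T: "T \<in> ob D" "is_direct_sum D 0 (\<lambda>_. undefined) T"
    using direct_sums_exist[of 0 "\<lambda>_. undefined"] by auto
  interpret A: abelian_group "Hom D T T" using T Hom_abelian by blast
  show ?thesis using T(2) zero_objectI[OF T(1)] unfolding is_direct_sum_def by auto
qed

text \<open>Any \<open>f\<close> that vanishes on \<open>X\<close> is part of a commuting square into the triangle
  \<open>0 \<rightarrow> N \<rightarrow> N \<rightarrow> 0[1]\<close>, and completing the square to a morphism of triangles yields the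
  factorisation: this is exactness of \<open>Hom(_, N)\<close> in the middle.\<close>

lemma factor_through_triangle:
  assumes t: "(X, Y, Z, u, v, w) \<in> tri D" and N: "N \<in> ob D" and f: "f \<in> Mor D Y N"
    and z: "cmp D X Y N f u = \<zero>\<^bsub>Hom D X N\<^esub>"
  shows "\<exists>g\<in>Mor D Z N. cmp D Y Z N g v = f"
proof -
  note o = triangle_obs[OF t]
  obtain T where zT: "zero_object D T" using zero_object_exists by blast
  then have T: "T \<in> ob D" by (simp add: zero_object_def)
  let ?z = "\<zero>\<^bsub>Hom D T N\<^esub>"
  have zN: "?z \<in> Mor D T N" using T N by simp
  interpret B: abelian_group "Hom D (shf D T) (shf D N)" using T N shf_closed Hom_abelian by blast
  let ?w = "\<zero>\<^bsub>Hom D N (shf D T)\<^esub>"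
  have it: "is_triangle D T N N ?z (ide D N) ?w"
    unfolding is_triangle_def using T N shf_closed ide_closed by simp
  have "(N, N, shf D T, ide D N, ?w, \<zero>\<^bsub>Hom D (shf D T) (shf D N)\<^esub>) \<in> tri D"
    using tri_ide[OF N shf_zero_object[OF zT]] .
  moreover have neg_zero: "\<ominus>\<^bsub>Hom D (shf D T) (shf D N)\<^esub> \<zero>\<^bsub>Hom D (shf D T) (shf D N)\<^esub> =
      \<zero>\<^bsub>Hom D (shf D T) (shf D N)\<^esub>"
    by (rule trans[OF B.l_zero[OF B.a_inv_closed[OF B.zero_closed], symmetric] B.r_neg[OF B.zero_closed]])
  ultimately have t': "(T, N, N, ?z, ide D N, ?w) \<in> tri D"
    using tri_rotate[OF it] unfolding shm_zero[OF T N] neg_zero by blast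
  let ?a = "\<zero>\<^bsub>Hom D X T\<^esub>"
  have "cmp D X Y N f u = cmp D X T N ?z ?a" using z cmp_zero_right[OF o(1) T N zN] by simp
  then obtain c where "triangle_morphism D X Y Z u v w T N N ?z (ide D N) ?w ?a f c"
    using tri_fill[OF t t' zero_closed[OF o(1) T] f] by blast
  then have "c \<in> Mor D Z N" "cmp D Y Z N c v = f"
    unfolding triangle_morphism_def using cmp_ide_left o N f by auto
  then show ?thesis by blast
qed

lemma no_mapsI: "\<lbrakk>X \<in> ob D; Y \<in> ob D; \<And>f. f \<in> Mor D X Y \<Longrightarrow> f = \<zero>\<^bsub>Hom D X Y\<^esub>\<rbrakk> \<Longrightarrow> no_maps D X Y"
  unfolding no_maps_def using zero_closed by blast

lemma no_mapsD: "no_maps D X Y \<Longrightarrow> f \<in> Mor D X Y \<Longrightarrow> f = \<zero>\<^bsub>Hom D X Y\<^esub>"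
  unfolding no_maps_def by blast

lemma no_maps_zero_object: "zero_object D X \<Longrightarrow> Y \<in> ob D \<Longrightarrow> no_maps D X Y"
  unfolding no_maps_def zero_object_def by blast

lemma no_maps_extension:
  assumes t: "(X, Y, Z, u, v, w) \<in> tri D" and N: "N \<in> ob D"
    and "no_maps D X N" "no_maps D Z N"
  shows "no_maps D Y N"
proof (rule no_mapsI)
  note o = triangle_obs[OF t]
  show "Y \<in> ob D" "N \<in> ob D" using o N by auto
  fix f assume f: "f \<in> Mor D Y N"
  have "cmp D X Y N f u = \<zero>\<^bsub>Hom D X N\<^esub>" using assms no_mapsD o f cmp_closed by blast
  then obtain g where g: "g \<in> Mor D Z N" "cmp D Y Z N g v = f"
    using factor_through_triangle[OF t N f] by blast
  then show "f = \<zero>\<^bsub>Hom D Y N\<^esub>" using no_mapsD[OF assms(4) g(1)] cmp_zero_left[OF o(2,3) N o(5)] by simp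
qed

text \<open>This is the exact sequence
  \<open>Hom(X[1], N) \<rightarrow> Hom(Z, N) \<rightarrow> Hom(Y, N) \<rightarrow> Hom(X, N)\<close> with vanishing outer terms.\<close>

lemma precomp_bij:
  assumes t: "(X, Y, Z, u, v, w) \<in> tri D" and N: "N \<in> ob D"
    and X: "no_maps D X N" and X1: "no_maps D (shf D X) N"
  shows "bij_betw (\<lambda>g. cmp D Y Z N g v) (Mor D Z N) (Mor D Y N)"
  unfolding bij_betw_def
proof
  note o = triangle_obs[OF t]
  interpret A: abelian_group "Hom D Z N" using o N Hom_abelian by blast
  interpret B: abelian_group "Hom D Y N" using o N Hom_abelian by blast
  show "inj_on (\<lambda>g. cmp D Y Z N g v) (Mor D Z N)"
  proof (rule inj_onI)
    fix g h assume gh: "g \<in> Mor D Z N" "h \<in> Mor D Z N" and eq: "cmp D Y Z N g v = cmp D Y Z N h v"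
    let ?d = "g \<ominus>\<^bsub>Hom D Z N\<^esub> h"
    have d: "?d \<in> Mor D Z N" using gh by simp
    have "cmp D Y Z N ?d v = \<zero>\<^bsub>Hom D Y N\<^esub>"
      using cmp_diff_left[OF o(2,3) N o(5) gh] eq cmp_closed[OF o(2,3) N o(5) gh(2)] by simp
    then obtain k where k: "k \<in> Mor D (shf D X) N" "cmp D Z (shf D X) N k w = ?d"
      using factor_through_triangle[OF rotate_triangle[OF t] N d] by blast
    then have "?d = \<zero>\<^bsub>Hom D Z N\<^esub>"
      using no_mapsD[OF X1 k(1)] cmp_zero_left[OF o(3) shf_closed[OF o(1)] N o(6)] by simp
    then show "g = h" using gh by simp
  qed
  show "(\<lambda>g. cmp D Y Z N g v) ` Mor D Z N = Mor D Y N"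
  proof
    show "(\<lambda>g. cmp D Y Z N g v) ` Mor D Z N \<subseteq> Mor D Y N" using o N cmp_closed by blast
    show "Mor D Y N \<subseteq> (\<lambda>g. cmp D Y Z N g v) ` Mor D Z N"
    proof
      fix f assume f: "f \<in> Mor D Y N"
      have "cmp D X Y N f u = \<zero>\<^bsub>Hom D X N\<^esub>" using X no_mapsD o N f cmp_closed by blast
      then show "f \<in> (\<lambda>g. cmp D Y Z N g v) ` Mor D Z N"
        using factor_through_triangle[OF t N f] by blast
    qed
  qed
qed

text \<open>A square-zero argument replaces the five lemma when the first two components are identities:
  \<open>(h - 1) v = 0\<close> gives \<open>h - 1 = k w\<close> for some \<open>k\<close>, and \<open>w (h - 1) = 0\<close>, so
  \<open>(h - 1)\<^sup>2 = k w (h - 1) = 0\<close>.\<close>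

lemma triangle_endo_is_iso:
  assumes t: "(X, Y, Z, u, v, w) \<in> tri D" and h: "h \<in> Mor D Z Z"
    and hv: "cmp D Y Z Z h v = v" and wh: "cmp D Z Z (shf D X) w h = w"
  shows "is_iso D Z Z h"
proof -
  note o = triangle_obs[OF t]
  note X1 = shf_closed[OF o(1)] and i = ide_closed[OF o(3)]
  interpret A: abelian_group "Hom D Z Z" using o Hom_abelian by blast
  interpret B: abelian_group "Hom D Y Z" using o Hom_abelian by blast
  interpret C: abelian_group "Hom D Z (shf D X)" using o X1 Hom_abelian by blast
  let ?e = "h \<ominus>\<^bsub>Hom D Z Z\<^esub> ide D Z"
  have e: "?e \<in> Mor D Z Z" using h i by simp
  have "cmp D Y Z Z ?e v = \<zero>\<^bsub>Hom D Y Z\<^esub>"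
    using cmp_diff_left[OF o(2,3,3,5) h i] hv cmp_ide_left[OF o(2,3,5)] o by simp
  then obtain k where k: "k \<in> Mor D (shf D X) Z" "cmp D Z (shf D X) Z k w = ?e"
    using factor_through_triangle[OF rotate_triangle[OF t] o(3) e] by blast
  have we: "cmp D Z Z (shf D X) w ?e = \<zero>\<^bsub>Hom D Z (shf D X)\<^esub>"
    using cmp_diff_right[OF o(3,3) X1 h i o(6)] wh cmp_ide_right[OF o(3) X1 o(6)] o by simp
  have "cmp D Z Z Z ?e ?e = cmp D Z (shf D X) Z k (cmp D Z Z (shf D X) w ?e)"
    using cmp_assoc[OF o(3,3) X1 o(3) e o(6) k(1)] k(2) by simp
  also have "\<dots> = \<zero>\<^bsub>Hom D Z Z\<^esub>" using we cmp_zero_right[OF o(3) X1 o(3) k(1)] by simp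
  finally show ?thesis using unipotent_is_iso[OF o(3) h refl] by blast
qed

text \<open>The morphisms \<open>c : Z \<rightarrow> Z'\<close> and \<open>d : Z' \<rightarrow> Z\<close> that complete the identities of \<open>X\<close> and
  \<open>Y\<close> need not be mutually inverse, but both composites are isomorphisms by the previous lemma.\<close>

lemma triangle_third_iso_same_ends:
  assumes t: "(X, Y, Z, u, v, w) \<in> tri D" and t': "(X, Y, Z', u, v', w') \<in> tri D"
  shows "isomorphic D Z Z'"
proof -
  note o = triangle_obs[OF t] and o' = triangle_obs[OF t']
  note X1 = shf_closed[OF o(1)] and i = ide_closed[OF o(1)] ide_closed[OF o(2)]
  have sq: "cmp D X Y Y (ide D Y) u = cmp D X X Y u (ide D X)"
    using cmp_ide_left[OF o(1,2,4)] cmp_ide_right[OF o(1,2,4)] by simp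
  obtain c where "triangle_morphism D X Y Z u v w X Y Z' u v' w' (ide D X) (ide D Y) c"
    using tri_fill[OF t t' i sq] by blast
  then have c: "c \<in> Mor D Z Z'" "cmp D Y Z Z' c v = v'" "cmp D Z Z' (shf D X) w' c = w"
    unfolding triangle_morphism_def
    using cmp_ide_right[OF o'(2,3,5)] cmp_ide_left[OF o(3) X1 o(6)] shm_ide[OF o(1)] by auto
  obtain d where "triangle_morphism D X Y Z' u v' w' X Y Z u v w (ide D X) (ide D Y) d"
    using tri_fill[OF t' t i sq] by blast
  then have d: "d \<in> Mor D Z' Z" "cmp D Y Z' Z d v' = v" "cmp D Z' Z (shf D X) w d = w'"
    unfolding triangle_morphism_def
    using cmp_ide_right[OF o(2,3,5)] cmp_ide_left[OF o'(3) X1 o'(6)] shm_ide[OF o(1)] by auto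
  have "is_iso D Z Z (cmp D Z Z' Z d c)"
  proof (rule triangle_endo_is_iso[OF t])
    show "cmp D Z Z' Z d c \<in> Mor D Z Z" using o o' c d cmp_closed by blast
    show "cmp D Y Z Z (cmp D Z Z' Z d c) v = v"
      using cmp_assoc[OF o(2,3) o'(3) o(3,5) c(1) d(1)] c d by simp
    show "cmp D Z Z (shf D X) w (cmp D Z Z' Z d c) = w"
      using cmp_assoc[OF o(3) o'(3) o(3) X1 c(1) d(1) o(6)] c d by simp
  qed
  moreover have "is_iso D Z' Z' (cmp D Z' Z Z' c d)"
  proof (rule triangle_endo_is_iso[OF t'])
    show "cmp D Z' Z Z' c d \<in> Mor D Z' Z'" using o o' c d cmp_closed by blast
    show "cmp D Y Z' Z' (cmp D Z' Z Z' c d) v' = v'"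
      using cmp_assoc[OF o'(2,3) o(3) o'(3,5) d(1) c(1)] c d by simp
    show "cmp D Z' Z' (shf D X) w' (cmp D Z' Z Z' c d) = w'"
      using cmp_assoc[OF o'(3) o(3) o'(3) X1 d(1) c(1) o'(6)] c d by simp
  qed
  ultimately show ?thesis
    using is_iso_of_both_sides[OF o(3) o'(3) c(1) d(1)] unfolding isomorphic_def by blast
qed

lemma triangle_transport_middle:
  assumes t: "(X, Y, Z, u, v, w) \<in> tri D" and Y': "Y' \<in> ob D" and "isomorphic D Y Y'"
  shows "\<exists>u v. (X, Y', Z, u, v, w) \<in> tri D"
proof -
  note o = triangle_obs[OF t]
  note X1 = shf_closed[OF o(1)]
  obtain a b where ab: "a \<in> Mor D Y Y'" "b \<in> Mor D Y' Y" "cmp D Y Y' Y b a = ide D Y"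
      "cmp D Y' Y Y' a b = ide D Y'"
    using assms(3) unfolding isomorphic_def is_iso_def by blast
  let ?u = "cmp D X Y Y' a u" and ?v = "cmp D Y' Y Z v b"
  have uv: "?u \<in> Mor D X Y'" "?v \<in> Mor D Y' Z" using o Y' ab cmp_closed by blast+
  have m: "triangle_morphism D X Y Z u v w X Y' Z ?u ?v w (ide D X) a (ide D Z)"
    unfolding triangle_morphism_def
    using o Y' ab uv ide_closed cmp_ide_left cmp_ide_right X1 shm_ide
      cmp_assoc[OF o(2) Y' o(2) o(3) ab(1) ab(2) o(5)] by simp
  have "is_iso D Y Y' a" using is_isoI ab by metis
  then have "(X, Y', Z, ?u, ?v, w) \<in> tri D"
    using tri_iso_closed[OF t _ m] is_iso_ide o Y' uv unfolding is_triangle_def by blast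
  then show ?thesis by blast
qed

lemma triangle_transport_third:
  assumes t: "(X, Y, Z, u, v, w) \<in> tri D" and Z': "Z' \<in> ob D" and a: "is_iso D Z Z' a"
  shows "\<exists>w. (X, Y, Z', u, cmp D Y Z Z' a v, w) \<in> tri D"
proof -
  note o = triangle_obs[OF t]
  note X1 = shf_closed[OF o(1)]
  obtain b where ab: "a \<in> Mor D Z Z'" "b \<in> Mor D Z' Z" "cmp D Z Z' Z b a = ide D Z"
    using a unfolding is_iso_def by blast
  let ?v = "cmp D Y Z Z' a v" and ?w = "cmp D Z' Z (shf D X) w b"
  have vw: "?v \<in> Mor D Y Z'" "?w \<in> Mor D Z' (shf D X)" using o Z' X1 ab cmp_closed by blast+
  have m: "triangle_morphism D X Y Z u v w X Y Z' u ?v ?w (ide D X) (ide D Y) a"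
    unfolding triangle_morphism_def
    using o Z' ab vw ide_closed cmp_ide_left cmp_ide_right X1 shm_ide
      cmp_assoc[OF o(3) Z' o(3) X1 ab(1) ab(2) o(6)] by simp
  have "(X, Y, Z', u, ?v, ?w) \<in> tri D"
    using tri_iso_closed[OF t _ m] is_iso_ide o Z' vw a unfolding is_triangle_def by blast
  then show ?thesis by blast
qed

lemma triangle_transport_first:
  assumes t: "(X, Y, Z, u, v, w) \<in> tri D" and X': "X' \<in> ob D" and i: "isomorphic D X X'"
  shows "\<exists>u w. (X', Y, Z, u, v, w) \<in> tri D"
proof -
  obtain a where "is_iso D (shf D X) (shf D X') a"
    using shf_iso[OF triangle_obs(1)[OF t] X' i] unfolding isomorphic_def by blast
  from triangle_transport_third[OF rotate_triangle[OF t] shf_closed[OF X'] this]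
  show ?thesis using unrotate_triangle[OF _ X'] by blast
qed

text \<open>Here \<open>v = 0\<close>, so the identity of \<open>Z\<close> factors through \<open>w : Z \<rightarrow> X[1]\<close> and hence is zero.\<close>

lemma triangle_third_zero:
  assumes t: "(X, Y, Z, u, v, w) \<in> tri D"
    and X1: "no_maps D (shf D X) Z" and Y: "no_maps D Y Z"
  shows "zero_object D Z"
proof -
  note o = triangle_obs[OF t]
  have "cmp D Y Z Z (ide D Z) v = \<zero>\<^bsub>Hom D Y Z\<^esub>"
    using no_mapsD[OF Y] cmp_ide_left[OF o(2,3,5)] o by simp
  then obtain k where k: "k \<in> Mor D (shf D X) Z" "cmp D Z (shf D X) Z k w = ide D Z"
    using factor_through_triangle[OF rotate_triangle[OF t] o(3) ide_closed[OF o(3)]] by blast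
  then have "ide D Z = \<zero>\<^bsub>Hom D Z Z\<^esub>"
    using no_mapsD[OF X1 k(1)] cmp_zero_left[OF o(3) shf_closed[OF o(1)] o(3) o(6)] by simp
  then show ?thesis using zero_objectI o by blast
qed

text \<open>By \<open>precomp_bij\<close>, composition with \<open>v\<close> is a bijection onto the morphisms from \<open>Y\<close> to
  \<open>Z\<close> or \<open>Z'\<close>, and so is composition with \<open>v'\<close>.  Both morphisms thus have the same universal
  property.\<close>

lemma triangle_comparison:
  assumes t: "(X, Y, Z, u, v, w) \<in> tri D" and t': "(X', Y, Z', u', v', w') \<in> tri D"
    and n: "no_maps D X Z" "no_maps D (shf D X) Z" "no_maps D X Z'" "no_maps D (shf D X) Z'"
      "no_maps D X' Z" "no_maps D (shf D X') Z" "no_maps D X' Z'" "no_maps D (shf D X') Z'"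
  shows "\<exists>a. is_iso D Z Z' a \<and> cmp D Y Z Z' a v = v'"
proof -
  note o = triangle_obs[OF t] and o' = triangle_obs[OF t']
  have "v' \<in> (\<lambda>a. cmp D Y Z Z' a v) ` Mor D Z Z'"
    using bij_betw_imp_surj_on[OF precomp_bij[OF t o'(3) n(3,4)]] o'(5) by simp
  then obtain a where a: "a \<in> Mor D Z Z'" "cmp D Y Z Z' a v = v'" by blast
  have "v \<in> (\<lambda>b. cmp D Y Z' Z b v') ` Mor D Z' Z"
    using bij_betw_imp_surj_on[OF precomp_bij[OF t' o(3) n(5,6)]] o(5) by simp
  then obtain b where b: "b \<in> Mor D Z' Z" "cmp D Y Z' Z b v' = v" by blast
  have "cmp D Z Z' Z b a = ide D Z"
  proof (rule inj_onD[OF bij_betw_imp_inj_on[OF precomp_bij[OF t o(3) n(1,2)]]])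
    show "cmp D Y Z Z (cmp D Z Z' Z b a) v = cmp D Y Z Z (ide D Z) v"
      using cmp_assoc[OF o(2,3) o'(3) o(3,5) a(1) b(1)] a b cmp_ide_left[OF o(2,3,5)] by simp
  qed (use o o' a b cmp_closed ide_closed in auto)
  moreover have "cmp D Z' Z Z' a b = ide D Z'"
  proof (rule inj_onD[OF bij_betw_imp_inj_on[OF precomp_bij[OF t' o'(3) n(7,8)]]])
    show "cmp D Y Z' Z' (cmp D Z' Z Z' a b) v' = cmp D Y Z' Z' (ide D Z') v'"
      using cmp_assoc[OF o'(2,3) o(3) o'(3,5) b(1) a(1)] a b cmp_ide_left[OF o'(2,3,5)] by simp
  qed (use o o' a b cmp_closed ide_closed in auto)
  ultimately show ?thesis using is_isoI[OF a(1) b(1)] a(2) by blast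
qed

text \<open>The comparison of \<open>v\<close> and \<open>v'\<close> makes \<open>X[1]\<close> and \<open>X'[1]\<close> cones of the same morphism.\<close>

lemma triangle_first_unique:
  assumes t: "(X, Y, Z, u, v, w) \<in> tri D" and t': "(X', Y, Z', u', v', w') \<in> tri D"
    and n: "no_maps D X Z" "no_maps D (shf D X) Z" "no_maps D X Z'" "no_maps D (shf D X) Z'"
      "no_maps D X' Z" "no_maps D (shf D X') Z" "no_maps D X' Z'" "no_maps D (shf D X') Z'"
  shows "isomorphic D X X'"
proof -
  note o = triangle_obs[OF t] and o' = triangle_obs[OF t']
  obtain a where a: "is_iso D Z Z' a" "cmp D Y Z Z' a v = v'"
    using triangle_comparison[OF t t' n] by blast
  obtain w'' where "(X, Y, Z', u, v', w'') \<in> tri D"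
    using triangle_transport_third[OF t o'(3) a(1)] a(2) by auto
  from triangle_third_iso_same_ends[OF rotate_triangle[OF this] rotate_triangle[OF t']]
  show ?thesis using iso_of_shf_iso o o' by blast
qed

section \<open>Hall numbers in the absence of maps from the subobject to the quotient\<close>

text \<open>Rotating turns a morphism with cone \<open>M[1]\<close> into the second morphism of a triangle that starts
  in \<open>M\<close>.\<close>

lemma Hom_with_cone_iff:
  assumes "M \<in> ob D"
  shows "f \<in> Hom_with_cone D L N (shf D M) \<longleftrightarrow> (\<exists>u w. (M, L, N, u, f, w) \<in> tri D)"
proof
  assume "f \<in> Hom_with_cone D L N (shf D M)"
  then obtain C g h where t: "(L, N, C, f, g, h) \<in> tri D" and i: "isomorphic D C (shf D M)"
    unfolding Hom_with_cone_def by blast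
  obtain a where "is_iso D C (shf D M) a" using i unfolding isomorphic_def by blast
  from triangle_transport_third[OF t shf_closed[OF assms] this]
  show "\<exists>u w. (M, L, N, u, f, w) \<in> tri D" using unrotate_triangle[OF _ assms] by blast
next
  assume "\<exists>u w. (M, L, N, u, f, w) \<in> tri D"
  then obtain u w where t: "(M, L, N, u, f, w) \<in> tri D" by blast
  show "f \<in> Hom_with_cone D L N (shf D M)"
    unfolding Hom_with_cone_def
    using rotate_triangle[OF t] triangle_obs[OF t] iso_refl[OF shf_closed[OF assms]] by blast
qed

text \<open>Composition makes \<open>Aut N\<close> act on the morphisms \<open>L \<rightarrow> N\<close> with cone \<open>M[1]\<close>.  The action is
  free because composition with \<open>f\<close> is injective, and transitive because any two such morphisms
  have the same universal property.\<close>

lemma card_Hom_with_cone: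
  assumes t: "(M, L, N, u, f, w) \<in> tri D"
    and n: "no_maps D M N" "no_maps D (shf D M) N"
  shows "card (Hom_with_cone D L N (shf D M)) = card (Aut D N)"
proof -
  note o = triangle_obs[OF t]
  have "bij_betw (\<lambda>a. cmp D L N N a f) (Aut D N) (Hom_with_cone D L N (shf D M))"
    unfolding bij_betw_def
  proof
    have sub: "Aut D N \<subseteq> Mor D N N" unfolding Aut_def is_iso_def by blast
    show "inj_on (\<lambda>a. cmp D L N N a f) (Aut D N)"
      using bij_betw_imp_inj_on[OF precomp_bij[OF t o(3) n]] sub by (rule inj_on_subset)
    show "(\<lambda>a. cmp D L N N a f) ` Aut D N = Hom_with_cone D L N (shf D M)"
    proof
      show "(\<lambda>a. cmp D L N N a f) ` Aut D N \<subseteq> Hom_with_cone D L N (shf D M)"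
        using triangle_transport_third[OF t o(3)] Hom_with_cone_iff[OF o(1)] unfolding Aut_def by blast
      show "Hom_with_cone D L N (shf D M) \<subseteq> (\<lambda>a. cmp D L N N a f) ` Aut D N"
      proof
        fix f' assume "f' \<in> Hom_with_cone D L N (shf D M)"
        then obtain u' w' where t': "(M, L, N, u', f', w') \<in> tri D"
          using Hom_with_cone_iff[OF o(1)] by blast
        show "f' \<in> (\<lambda>a. cmp D L N N a f) ` Aut D N"
          using triangle_comparison[OF t t' n n n n] unfolding Aut_def by blast
      qed
    qed
  qed
  then show ?thesis by (simp add: bij_betw_same_card)
qed

text \<open>Each shifted triangle identifies \<open>Hom(L[i], N)\<close> with \<open>Hom(N[i], N)\<close>, so the two products agree
  factor by factor.\<close>

lemma hom_euler_eq:
  assumes t: "(M, L, N, u, f, w) \<in> tri D" and n: "\<And>i. no_maps D (shfn D i M) N"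
  shows "hom_euler D L N = hom_euler D N N"
proof -
  have *: "card (Mor D (shfn D i L) N) = card (Mor D (shfn D i N) N)" for i
  proof -
    obtain u v w where "(shfn D i M, shfn D i L, shfn D i N, u, v, w) \<in> tri D"
      using shift_triangle[OF t] by blast
    from precomp_bij[OF this triangle_obs(3)[OF t] n] n[of "Suc i"] show ?thesis
      by (simp add: bij_betw_same_card)
  qed
  show ?thesis unfolding hom_euler_def by (simp only: *)
qed

end

context linear_category
begin

lemma finite_Mor:
  assumes K: "finite (carrier K)" and o: "X \<in> ob D" "Y \<in> ob D"
    and d: "vectorspace.fin_dim K (Hom D X Y)"
  shows "finite (Mor D X Y)"
proof -
  interpret V: vectorspace K "Hom D X Y"
    using Hom_module[OF o] field_axioms by (simp add: vectorspace_def)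
  obtain A where A: "finite A" "A \<subseteq> Mor D X Y" "V.gen_set A" using d V.fin_dim_def by auto
  have "Mor D X Y = {V.lincomb a A | a. a \<in> A \<rightarrow> carrier K}"
    using A V.finite_span by simp
  also have "\<dots> \<subseteq> (\<lambda>a. V.lincomb a A) ` (A \<rightarrow>\<^sub>E carrier K)"
  proof
    fix x assume "x \<in> {V.lincomb a A | a. a \<in> A \<rightarrow> carrier K}"
    then obtain a where a: "a \<in> A \<rightarrow> carrier K" "x = V.lincomb a A" by blast
    \<comment> \<open>Only the values of \<open>a\<close> on \<open>A\<close> matter, and there are finitely many restrictions.\<close>
    have "V.lincomb a A = V.lincomb (restrict a A) A"
      unfolding V.lincomb_def by (rule V.finsum_cong') (use a A in \<open>auto intro!: V.smult_closed\<close>)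
    then show "x \<in> (\<lambda>a. V.lincomb a A) ` (A \<rightarrow>\<^sub>E carrier K)"
      using a by (intro image_eqI[where x = "restrict a A"]) auto
  qed
  finally have sub: "Mor D X Y \<subseteq> (\<lambda>a. V.lincomb a A) ` (A \<rightarrow>\<^sub>E carrier K)" .
  show ?thesis by (rule finite_subset[OF sub finite_imageI[OF finite_PiE]]) (use A(1) K in auto)
qed

end

lemma Prod_any_nonzero:
  fixes g :: "'a \<Rightarrow> 'b::semidom"
  assumes "\<And>i. g i \<noteq> 0"
  shows "Prod_any g \<noteq> 0"
proof (cases "finite {i. g i \<noteq> 1}")
  case True
  then show ?thesis using assms by (simp add: Prod_any.expand_set prod_zero_iff)
next
  \<comment> \<open>With infinitely many factors different from \<open>1\<close>, the product is \<open>1\<close> by definition.\<close>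
  case False
  then show ?thesis by simp
qed

context triangulated_category
begin

text \<open>If a triangle exists, there are as many morphisms with cone \<open>M[1]\<close> as automorphisms of \<open>N\<close>, and
  the two Euler products agree.  All of these numbers are nonzero because the Hom spaces are finite,
  so both quotients are \<open>1\<close>.  If no triangle exists, no morphism has cone \<open>M[1]\<close>.\<close>

lemma hall_number_eq:
  assumes K: "finite (carrier K)" and lhf: "left_homologically_finite K D"
    and o: "M \<in> ob D" "N \<in> ob D" and n: "\<And>i. no_maps D (shfn D i M) N"
  shows "hall_number D M N L = (if \<exists>u v w. (M, L, N, u, v, w) \<in> tri D then 1 else 0)"
proof (cases "\<exists>u v w. (M, L, N, u, v, w) \<in> tri D")
  case True
  then obtain u f w where t: "(M, L, N, u, f, w) \<in> tri D" by blast
  have fin: "finite (Mor D (shfn D i N) N)" for i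
    using finite_Mor[OF K shfn_closed[OF o(2)] o(2)] lhf o(2)
    unfolding left_homologically_finite_def by blast
  have "Aut D N \<subseteq> Mor D N N" unfolding Aut_def is_iso_def by blast
  then have "finite (Aut D N)" using fin[of 0] finite_subset by auto
  moreover have "ide D N \<in> Aut D N" using is_iso_ide o unfolding Aut_def by blast
  ultimately have "card (Aut D N) \<noteq> 0" by auto
  moreover have "hom_euler D N N \<noteq> 0" unfolding hom_euler_def
  proof (rule Prod_any_nonzero)
    fix i
    have "shfn D (Suc i) N \<in> ob D" using shfn_closed o by blast
    then have "Mor D (shfn D (Suc i) N) N \<noteq> {}" using zero_closed o by blast
    then show "(of_nat (card (Mor D (shfn D (Suc i) N) N)) :: rat) powi ((- 1) ^ Suc i) \<noteq> 0"
      using fin[of "Suc i"] by (simp only: power_int_eq_0_iff of_nat_eq_0_iff card_0_eq) blast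
  qed
  ultimately show ?thesis
    unfolding hall_number_def
    using True card_Hom_with_cone[OF t] hom_euler_eq[OF t n] n[of 0] n[of 1] by simp
next
  case False
  then have "Hom_with_cone D L N (shf D M) = {}" using Hom_with_cone_iff[OF o(1)] by blast
  then show ?thesis using False by (simp add: hall_number_def)
qed

end

section \<open>Classes in the Grothendieck group\<close>

context triangulated_category
begin

lemma k0_relations_carrier: "k0_relations D \<subseteq> carrier (free_Abelian_group (ob D))"
proof
  fix r assume "r \<in> k0_relations D"
  then obtain X Y C u v w where r: "r = frag_of Y - frag_of X - frag_of C"
    and t: "(X, Y, C, u, v, w) \<in> tri D"
    unfolding k0_relations_def by blast
  note o = triangle_obs[OF t]
  have "Poly_Mapping.keys (frag_of Y - frag_of X) \<subseteq> ob D"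
    using keys_diff[of "frag_of Y" "frag_of X"] o by auto
  then show "r \<in> carrier (free_Abelian_group (ob D))"
    using keys_diff[of "frag_of Y - frag_of X" "frag_of C"] o r by auto
qed

lemma k0_subgroup_normal: "k0_subgroup D \<lhd> free_Abelian_group (ob D)"
proof -
  interpret F: comm_group "free_Abelian_group (ob D)" by (rule abelian_free_Abelian_group)
  show ?thesis
    unfolding k0_subgroup_def
    using F.generate_is_subgroup[OF k0_relations_carrier] F.subgroup_imp_normal by blast
qed

lemma K0_comm_group: "comm_group (K0 D)"
proof -
  interpret F: comm_group "free_Abelian_group (ob D)" by (rule abelian_free_Abelian_group)
  show ?thesis
    unfolding K0_def using F.abelian_FactGroup normal_imp_subgroup[OF k0_subgroup_normal] by blast
qed

lemma k0_class_closed: "M \<in> ob D \<Longrightarrow> k0_class D M \<in> carrier (K0 D)"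
  unfolding K0_def k0_class_def carrier_FactGroup by simp

text \<open>The defining relations of \<open>K\<^sub>0\<close>, read in the quotient group.\<close>

lemma k0_class_triangle:
  assumes t: "(X, Y, C, u, v, w) \<in> tri D"
  shows "k0_class D Y = k0_class D X \<otimes>\<^bsub>K0 D\<^esub> k0_class D C"
proof -
  let ?F = "free_Abelian_group (ob D)"
  interpret F: comm_group ?F by (rule abelian_free_Abelian_group)
  interpret N: normal "k0_subgroup D" ?F by (rule k0_subgroup_normal)
  note o = triangle_obs[OF t]
  have X: "frag_of X \<in> carrier ?F" and C: "frag_of C \<in> carrier ?F" and Y: "frag_of Y \<in> carrier ?F"
    using o by simp_all
  let ?r = "frag_of Y - frag_of X - frag_of C"
  have "?r \<in> k0_relations D" using t unfolding k0_relations_def by blast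
  then have r: "?r \<in> k0_subgroup D" unfolding k0_subgroup_def by (rule generate.incl)
  have XC: "frag_of X \<otimes>\<^bsub>?F\<^esub> frag_of C \<in> carrier ?F" using X C by (rule F.m_closed)
  have "frag_of Y = ?r \<otimes>\<^bsub>?F\<^esub> (frag_of X \<otimes>\<^bsub>?F\<^esub> frag_of C)" by simp
  then have "frag_of Y \<in> k0_subgroup D #>\<^bsub>?F\<^esub> (frag_of X \<otimes>\<^bsub>?F\<^esub> frag_of C)"
    using r unfolding r_coset_def by blast
  then have "k0_subgroup D #>\<^bsub>?F\<^esub> frag_of Y = k0_subgroup D #>\<^bsub>?F\<^esub> (frag_of X \<otimes>\<^bsub>?F\<^esub> frag_of C)"
    using F.repr_independence XC N.subgroup_axioms by metis
  then show ?thesis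
    unfolding k0_class_def K0_def mult_FactGroup N.rcos_sum[OF X C] .
qed

lemma k0_class_zero_object:
  assumes "zero_object D X"
  shows "k0_class D X = \<one>\<^bsub>K0 D\<^esub>"
proof -
  interpret G: comm_group "K0 D" by (rule K0_comm_group)
  have X: "X \<in> ob D" using assms by (simp add: zero_object_def)
  have "k0_class D X = k0_class D X \<otimes>\<^bsub>K0 D\<^esub> k0_class D X"
    using k0_class_triangle[OF tri_ide[OF X assms]] .
  then show ?thesis using k0_class_closed[OF X] G.l_cancel_one by metis
qed

text \<open>Isomorphic objects are the first two terms of a triangle \<open>X \<rightarrow> Y \<rightarrow> 0\<close>.\<close>

lemma k0_class_iso:
  assumes "X \<in> ob D" "Y \<in> ob D" "isomorphic D X Y"
  shows "k0_class D X = k0_class D Y"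
proof -
  interpret G: comm_group "K0 D" by (rule K0_comm_group)
  obtain T where T: "zero_object D T" using zero_object_exists by blast
  obtain u v w where "(X, Y, T, u, v, w) \<in> tri D"
    using triangle_transport_middle[OF tri_ide[OF assms(1) T] assms(2,3)] by blast
  from k0_class_triangle[OF this] show ?thesis
    using k0_class_zero_object[OF T] k0_class_closed[OF assms(1)] by simp
qed

end

section \<open>Phases and types of filtrations\<close>

lemma phase_window_unique: "\<phi> \<in> phase_window m \<Longrightarrow> \<phi> \<in> phase_window m' \<Longrightarrow> m = m'"
  unfolding phase_window_def by auto

lemma phase_window_exists: "\<exists>m. \<phi> \<in> phase_window m"
proof
  define m where "m = \<lceil>(\<phi> - 1) / 2\<rceil>"
  have "real_of_int m - 1 < (\<phi> - 1) / 2 \<and> (\<phi> - 1) / 2 \<le> real_of_int m"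
    unfolding m_def by (rule ceiling_correct)
  then show "\<phi> \<in> phase_window m"
    unfolding phase_window_def greaterThanAtMost_iff by (auto simp: field_simps)
qed

text \<open>The half-open window has length \<open>2\<close>, the period of \<open>\<phi> \<mapsto> exp (\<i> \<pi> \<phi>)\<close>.\<close>

lemma polar_phase_unique:
  fixes r s :: real
  assumes "\<phi> \<in> phase_window m" "\<psi> \<in> phase_window m" "r > 0" "s > 0"
    and eq: "complex_of_real r * exp (\<i> * complex_of_real (pi * \<phi>)) =
      complex_of_real s * exp (\<i> * complex_of_real (pi * \<psi>))"
  shows "\<phi> = \<psi>"
proof -
  have eq': "complex_of_real r * cis (pi * \<phi>) = complex_of_real s * cis (pi * \<psi>)"
    using eq by (simp add: cis_conv_exp)
  then have "cmod (complex_of_real r * cis (pi * \<phi>)) = cmod (complex_of_real s * cis (pi * \<psi>))"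
    by simp
  then have "r = s" using assms(3,4) by (simp add: norm_mult)
  then have "cis (pi * \<phi>) = cis (pi * \<psi>)" using eq' assms(4) by simp
  then have "sin (pi * \<phi>) = sin (pi * \<psi>) \<and> cos (pi * \<phi>) = cos (pi * \<psi>)"
    by (simp add: complex_eq_iff)
  then obtain n :: int where "pi * \<phi> = pi * \<psi> + 2 * pi * real_of_int n"
    using sin_cos_eq_iff by metis
  then have "pi * \<phi> = pi * (\<psi> + 2 * real_of_int n)" by (simp add: algebra_simps)
  then have n: "\<phi> = \<psi> + 2 * real_of_int n" by simp
  then have "real_of_int n < 1" "real_of_int n > -1"
    using assms(1,2) unfolding phase_window_def by auto
  then have "n = 0" by linarith
  then show ?thesis using n by simp
qed

abbreviation phi_of :: "('g \<Rightarrow> complex) \<Rightarrow> 'g \<times> int \<Rightarrow> real" where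
  "phi_of Z t \<equiv> phi_m Z (snd t) (fst t)"

abbreviation decreasing :: "('g \<Rightarrow> complex) \<Rightarrow> ('g \<times> int) list \<Rightarrow> bool" where
  "decreasing Z \<equiv> sorted_wrt (\<lambda>(\<gamma>\<^sub>1, m\<^sub>1) (\<gamma>\<^sub>2, m\<^sub>2). phi_m Z m\<^sub>1 \<gamma>\<^sub>1 > phi_m Z m\<^sub>2 \<gamma>\<^sub>2)"

lemma decreasing_snoc:
  "decreasing Z (ts @ [t]) \<longleftrightarrow> decreasing Z ts \<and> (\<forall>s\<in>set ts. phi_of Z s > phi_of Z t)"
  by (auto simp: sorted_wrt_append split: prod.splits)

definition hn_factor :: "('o, 'm, 'k, 'z) tricat_scheme \<Rightarrow> (real \<Rightarrow> 'o set) \<Rightarrow>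
    ('o \<Rightarrow>\<^sub>0 int) set \<times> int \<Rightarrow> 'o \<Rightarrow> bool" where
  "hn_factor D P t A \<longleftrightarrow> \<not> zero_object D A \<and> k0_class D A = fst t \<and>
     (\<exists>\<phi>\<in>phase_window (snd t). A \<in> P \<phi>)"

text \<open>A filtration is recorded by the classes and windows of its factors alone.  The list grows at the
  end, as the left-bracketed products do, and a step of the filtration is then a factor of such a
  product.  Whether the phases decrease depends only on the list and on \<open>Z\<close>, so this is stated
  separately by \<open>decreasing\<close>.\<close>

inductive hn_typed :: "('o, 'm, 'k, 'z) tricat_scheme \<Rightarrow> (real \<Rightarrow> 'o set) \<Rightarrow>
    (('o \<Rightarrow>\<^sub>0 int) set \<times> int) list \<Rightarrow> 'o \<Rightarrow> bool"
  for D :: "('o, 'm, 'k, 'z) tricat_scheme" and P where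
  zero: "zero_object D M \<Longrightarrow> hn_typed D P [] M"
| snoc: "\<lbrakk>hn_typed D P ts E; (E, M, A, u, v, w) \<in> tri D; hn_factor D P t A\<rbrakk>
    \<Longrightarrow> hn_typed D P (ts @ [t]) M"

lemma hn_typed_Nil_iff: "hn_typed D P [] M \<longleftrightarrow> zero_object D M"
  by (auto elim: hn_typed.cases intro: hn_typed.zero)

lemma hn_typed_snocE:
  assumes "hn_typed D P (ts @ [t]) M"
  obtains E A u v w where "hn_typed D P ts E" "(E, M, A, u, v, w) \<in> tri D" "hn_factor D P t A"
  using assms by (cases rule: hn_typed.cases) auto

locale stability_category = triangulated_category K D
  for K :: "('k, 'r) ring_scheme" and D :: "('o, 'm, 'k, 'z) tricat_scheme" +
  fixes Z :: "('o \<Rightarrow>\<^sub>0 int) set \<Rightarrow> complex" and P :: "real \<Rightarrow> 'o set"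
  assumes stability: "stability_condition D Z P"
begin

lemma P_ob: "M \<in> P \<phi> \<Longrightarrow> M \<in> ob D"
  using stability unfolding stability_condition_def additive_subcategory_def by blast

lemma P_iso:
  assumes "M \<in> P \<phi>" "N \<in> ob D" "isomorphic D M N"
  shows "N \<in> P \<phi>"
proof -
  have "additive_subcategory D (P \<phi>)" using stability unfolding stability_condition_def by blast
  then show ?thesis
    using iso_is_direct_sum[OF P_ob[OF assms(1)] assms(2,3)] assms(1)
    unfolding additive_subcategory_def by metis
qed

lemma P_shift: "M \<in> P \<phi> \<Longrightarrow> shfn D i M \<in> P (\<phi> + real i)"
proof (induction i)
  case (Suc i)
  then have M: "shfn D i M \<in> P (\<phi> + real i)" by blast
  have "P (\<phi> + real i + 1) = {X \<in> ob D. \<exists>Y\<in>P (\<phi> + real i). isomorphic D X (shf D Y)}"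
    using stability unfolding stability_condition_def by blast
  moreover have "shf D (shfn D i M) \<in> ob D" using P_ob[OF M] shf_closed by blast
  ultimately have "shf D (shfn D i M) \<in> P (\<phi> + real i + 1)" using M iso_refl by blast
  then show ?case by (simp add: add_ac)
qed simp

lemma P_no_maps: "\<lbrakk>A \<in> P \<phi>; B \<in> P \<psi>; \<phi> > \<psi>\<rbrakk> \<Longrightarrow> no_maps D A B"
  using stability unfolding stability_condition_def no_maps_def by blast

lemma P_phase_unique:
  assumes "M \<in> P \<phi>" "M \<in> P \<psi>" "\<not> zero_object D M"
  shows "\<phi> = \<psi>"
  using P_no_maps[OF assms(1,2)] P_no_maps[OF assms(2,1)] assms(3)
    zero_object_if_Mor_self[OF P_ob[OF assms(1)]]
  unfolding no_maps_def by (meson linorder_neqE_linordered_idom)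

lemma phase_eq: "M \<in> P \<phi> \<Longrightarrow> \<not> zero_object D M \<Longrightarrow> phase P M = \<phi>"
  unfolding phase_def using P_phase_unique by blast

lemma Z_one: "Z \<one>\<^bsub>K0 D\<^esub> = 0"
proof -
  interpret G: comm_group "K0 D" by (rule K0_comm_group)
  have "Z \<in> hom (K0 D) complex_add_group"
    using stability unfolding stability_condition_def by blast
  then have "Z (\<one>\<^bsub>K0 D\<^esub> \<otimes>\<^bsub>K0 D\<^esub> \<one>\<^bsub>K0 D\<^esub>) = Z \<one>\<^bsub>K0 D\<^esub> + Z \<one>\<^bsub>K0 D\<^esub>"
    using G.one_closed unfolding hom_def complex_add_group_def by fastforce
  then show ?thesis by simp
qed

lemma semistable_phase:
  assumes "M \<in> P \<phi>" "\<not> zero_object D M" "\<phi> \<in> phase_window m"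
  shows "phi_m Z m (k0_class D M) = \<phi>" "Z (k0_class D M) \<noteq> 0" "k0_class D M \<noteq> \<one>\<^bsub>K0 D\<^esub>"
proof -
  obtain r where r: "r > 0" "Z (k0_class D M) = complex_of_real r * exp (\<i> * complex_of_real (pi * \<phi>))"
    using stability assms unfolding stability_condition_def by blast
  show "phi_m Z m (k0_class D M) = \<phi>"
    unfolding phi_m_def
  proof (rule the_equality)
    show "\<phi> \<in> phase_window m \<and>
        (\<exists>r>0. Z (k0_class D M) = complex_of_real r * exp (\<i> * complex_of_real (pi * \<phi>)))"
      using assms r by blast
    fix \<psi> assume "\<psi> \<in> phase_window m \<and>
        (\<exists>r>0. Z (k0_class D M) = complex_of_real r * exp (\<i> * complex_of_real (pi * \<psi>)))"
    then show "\<psi> = \<phi>" using polar_phase_unique[of \<psi> m \<phi>] assms r by auto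
  qed
  show "Z (k0_class D M) \<noteq> 0" using r by simp
  then show "k0_class D M \<noteq> \<one>\<^bsub>K0 D\<^esub>" using Z_one by auto
qed

text \<open>The class determines the phase modulo \<open>2\<close> through \<open>Z\<close>, and the window selects one value, so the
  phase of a factor depends only on its entry \<open>t\<close> in the list.\<close>

lemma hn_factor_phase:
  assumes "hn_factor D P t A"
  shows "A \<in> P (phi_of Z t)" "phi_of Z t \<in> phase_window (snd t)" "\<not> zero_object D A" "A \<in> ob D"
    "fst t = k0_class D A" "Z (fst t) \<noteq> 0" "fst t \<noteq> \<one>\<^bsub>K0 D\<^esub>"
proof -
  obtain \<phi> where \<phi>: "\<phi> \<in> phase_window (snd t)" "A \<in> P \<phi>" and A: "\<not> zero_object D A" "k0_class D A = fst t"
    using assms unfolding hn_factor_def by blast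
  note s = semistable_phase[OF \<phi>(2) A(1) \<phi>(1), unfolded A(2)]
  show "A \<in> P (phi_of Z t)" "phi_of Z t \<in> phase_window (snd t)" "\<not> zero_object D A" "A \<in> ob D"
    "fst t = k0_class D A" "Z (fst t) \<noteq> 0" "fst t \<noteq> \<one>\<^bsub>K0 D\<^esub>"
    using \<phi> A s P_ob by auto
qed

lemma hn_factor_iso:
  assumes "hn_factor D P t A" "B \<in> ob D" "isomorphic D A B"
  shows "hn_factor D P t B"
  using assms hn_factor_phase(4)[OF assms(1)] k0_class_iso[of A B] P_iso[of A _ B]
    zero_object_iso[of B A] iso_sym[of A B]
  unfolding hn_factor_def by metis

section \<open>Uniqueness and existence of the Harder-Narasimhan type\<close>

lemma hn_typed_ob: "hn_typed D P ts M \<Longrightarrow> M \<in> ob D"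
  by (cases rule: hn_typed.cases) (auto simp: zero_object_def dest: triangle_obs)

lemma hn_typed_iso:
  assumes "hn_typed D P ts M" "N \<in> ob D" "isomorphic D M N"
  shows "hn_typed D P ts N"
  using assms(1)
proof (cases rule: hn_typed.cases)
  case zero
  then show ?thesis using zero_object_iso[OF _ assms(2,3)] hn_typed.zero by simp
next
  case (snoc ts' E A u v w t)
  obtain u' v' where "(E, N, A, u', v', w) \<in> tri D"
    using triangle_transport_middle[OF snoc(3) assms(2,3)] by blast
  then show ?thesis using hn_typed.snoc[OF snoc(2) _ snoc(4)] snoc(1) by simp
qed

text \<open>The factors of \<open>M[i]\<close> have phases that are larger by \<open>i\<close>, so for every \<open>i \<ge> 0\<close> none of them
  has a nonzero map to \<open>N\<close>.  Uniqueness of filtrations needs \<open>i = 0\<close> and \<open>i = 1\<close>, whereas the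
  Euler products in the Hall numbers need all \<open>i\<close>.\<close>

lemma hn_typed_no_maps:
  assumes "hn_typed D P ts M" "\<forall>s\<in>set ts. phi_of Z s > \<psi>" "N \<in> P \<psi>"
  shows "no_maps D (shfn D i M) N"
  using assms
proof (induction rule: hn_typed.induct)
  case (zero M)
  then show ?case using no_maps_zero_object[OF shfn_zero_object] P_ob by blast
next
  case (snoc ts E M A u v w t)
  obtain u v w where t: "(shfn D i E, shfn D i M, shfn D i A, u, v, w) \<in> tri D"
    using shift_triangle[OF snoc(2)] by blast
  have "no_maps D (shfn D i E) N" using snoc by simp
  moreover have "no_maps D (shfn D i A) N"
    using P_no_maps[OF P_shift[OF hn_factor_phase(1)[OF snoc(3)]] snoc(6)] snoc(5) by fastforce
  ultimately show ?case using no_maps_extension[OF t P_ob[OF snoc(6)]] by blast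
qed

text \<open>If the phase of \<open>A'\<close> were smaller than that of \<open>A\<close>, then neither \<open>A\<close> nor \<open>E\<close>, and hence not
  \<open>L\<close>, would have a nonzero map to \<open>A'\<close>, which forces \<open>A' = 0\<close>.\<close>

lemma hn_last_phase_le:
  assumes "hn_typed D P ts E" "(E, L, A, u, v, w) \<in> tri D" "hn_factor D P t A"
    and ts: "\<forall>s\<in>set ts. phi_of Z s > phi_of Z t"
    and "hn_typed D P ts' E'" "(E', L, A', u', v', w') \<in> tri D" "hn_factor D P t' A'"
    and ts': "\<forall>s\<in>set ts'. phi_of Z s > phi_of Z t'"
  shows "phi_of Z t \<le> phi_of Z t'"
proof (rule ccontr)
  assume "\<not> ?thesis"
  then have less: "phi_of Z t' < phi_of Z t" by simp
  note A = hn_factor_phase[OF assms(3)] and A' = hn_factor_phase[OF assms(7)]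
  have "no_maps D (shfn D 0 E) A'"
    using hn_typed_no_maps[OF assms(1) _ A'(1)] ts less by fastforce
  moreover have "no_maps D A A'" using P_no_maps A(1) A'(1) less by blast
  ultimately have "no_maps D L A'" using no_maps_extension[OF assms(2) A'(4)] by simp
  moreover have "no_maps D (shf D E') A'"
    using hn_typed_no_maps[OF assms(5) ts' A'(1), of 1] by simp
  ultimately show False using triangle_third_zero[OF assms(6)] A'(3) by blast
qed

text \<open>Both inequalities together give equal phases, and then \<open>E\<close> and \<open>E'\<close> have no maps to either
  quotient, so the two triangles can be compared.\<close>

lemma hn_last_step_unique:
  assumes "hn_typed D P ts E" "(E, L, A, u, v, w) \<in> tri D" "hn_factor D P t A"
    and ts: "\<forall>s\<in>set ts. phi_of Z s > phi_of Z t"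
    and "hn_typed D P ts' E'" "(E', L, A', u', v', w') \<in> tri D" "hn_factor D P t' A'"
    and ts': "\<forall>s\<in>set ts'. phi_of Z s > phi_of Z t'"
  shows "t = t'" "isomorphic D E E'" "isomorphic D A A'"
proof -
  note A = hn_factor_phase[OF assms(3)] and A' = hn_factor_phase[OF assms(7)]
  have eq: "phi_of Z t = phi_of Z t'"
    using hn_last_phase_le[OF assms] hn_last_phase_le[OF assms(5-8) assms(1-4)] by simp
  have n: "no_maps D (shfn D i E) A" "no_maps D (shfn D i E) A'"
      "no_maps D (shfn D i E') A" "no_maps D (shfn D i E') A'" for i
    using hn_typed_no_maps[OF assms(1)] hn_typed_no_maps[OF assms(5)] ts ts' A(1) A'(1) eq by metis+
  note n0 = n[of 0, simplified] and n1 = n[of 1, simplified]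
  obtain a where "is_iso D A A' a"
    using triangle_comparison[OF assms(2,6) n0(1) n1(1) n0(2) n1(2) n0(3) n1(3) n0(4) n1(4)] by blast
  then show iso: "isomorphic D A A'" unfolding isomorphic_def by blast
  show "isomorphic D E E'"
    using triangle_first_unique[OF assms(2,6) n0(1) n1(1) n0(2) n1(2) n0(3) n1(3) n0(4) n1(4)] .
  have "fst t = fst t'" using k0_class_iso[OF A(4) A'(4) iso] A(5) A'(5) by simp
  moreover have "snd t = snd t'" using A(2) A'(2) eq phase_window_unique by metis
  ultimately show "t = t'" by (rule prod_eqI)
qed

text \<open>Otherwise the last quotient \<open>A\<close> would receive no maps from \<open>M = 0\<close> or from \<open>E[1]\<close>, and so be
  zero.\<close>

lemma hn_typed_nonzero:
  assumes "hn_typed D P ts M" "decreasing Z ts" "ts \<noteq> []"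
  shows "\<not> zero_object D M"
proof
  assume z: "zero_object D M"
  obtain ts' t where ts: "ts = ts' @ [t]" using assms(3) by (metis rev_exhaust)
  obtain E A u v w where h: "hn_typed D P ts' E" "(E, M, A, u, v, w) \<in> tri D" "hn_factor D P t A"
    using assms(1) hn_typed_snocE unfolding ts by metis
  note A = hn_factor_phase[OF h(3)]
  have "\<forall>s\<in>set ts'. phi_of Z s > phi_of Z t" using assms(2) unfolding ts decreasing_snoc by blast
  then have "no_maps D (shf D E) A" using hn_typed_no_maps[OF h(1) _ A(1), of 1] by simp
  then have "zero_object D A"
    using triangle_third_zero[OF h(2)] no_maps_zero_object[OF z A(4)] by blast
  then show False using A(3) by blast
qed

lemma hn_typed_unique:
  assumes "hn_typed D P ts M" "hn_typed D P ts' M" "decreasing Z ts" "decreasing Z ts'"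
  shows "ts = ts'"
  using assms
proof (induction ts arbitrary: ts' M rule: rev_induct)
  case Nil
  then have "zero_object D M" by (simp only: hn_typed_Nil_iff)
  then show ?case using hn_typed_nonzero[OF Nil(2,4)] by auto
next
  case (snoc t ts)
  have "\<not> zero_object D M" using hn_typed_nonzero[OF snoc.prems(1,3)] by simp
  then have "ts' \<noteq> []" using snoc.prems(2) by (auto simp: hn_typed_Nil_iff)
  then obtain us s where ts': "ts' = us @ [s]" by (metis rev_exhaust)
  obtain E A u v w where h: "hn_typed D P ts E" "(E, M, A, u, v, w) \<in> tri D" "hn_factor D P t A"
    using snoc.prems(1) hn_typed_snocE by metis
  obtain E' A' u' v' w' where
    h': "hn_typed D P us E'" "(E', M, A', u', v', w') \<in> tri D" "hn_factor D P s A'"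
    using snoc.prems(2) hn_typed_snocE unfolding ts' by metis
  have d: "decreasing Z ts" "\<forall>s\<in>set ts. phi_of Z s > phi_of Z t"
    using snoc.prems(3) unfolding decreasing_snoc by blast+
  have d': "decreasing Z us" "\<forall>r\<in>set us. phi_of Z r > phi_of Z s"
    using snoc.prems(4) unfolding ts' decreasing_snoc by blast+
  note un = hn_last_step_unique[OF h d(2) h' d'(2)]
  have "hn_typed D P us E" using hn_typed_iso[OF h'(1) hn_typed_ob[OF h(1)] iso_sym[OF un(2)]] .
  then show ?case using snoc.IH[OF h(1) _ d(1) d'(1)] un(1) ts' by simp
qed

lemma hn_typed_entries:
  assumes "hn_typed D P ts M"
  shows "\<forall>(\<gamma>, m)\<in>set ts. \<gamma> \<in> carrier (K0 D) \<and> \<gamma> \<noteq> \<one>\<^bsub>K0 D\<^esub> \<and> Z \<gamma> \<noteq> 0"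
  using assms
proof (induction rule: hn_typed.induct)
  case (snoc ts E M A u v w t)
  then show ?case using hn_factor_phase[OF snoc(3)] k0_class_closed by (cases t) auto
qed simp

lemma hn_typed_k0_class:
  assumes "hn_typed D P ts M"
  shows "foldr (\<otimes>\<^bsub>K0 D\<^esub>) (map fst ts) \<one>\<^bsub>K0 D\<^esub> = k0_class D M"
  using assms
proof (induction rule: hn_typed.induct)
  case (zero M)
  then show ?case using k0_class_zero_object by simp
next
  case (snoc ts E M A u v w t)
  interpret G: comm_group "K0 D" by (rule K0_comm_group)
  \<comment> \<open>The product is folded from the right, whereas the new factor is appended on the right.\<close>
  have fold: "foldr (\<otimes>\<^bsub>K0 D\<^esub>) xs a = foldr (\<otimes>\<^bsub>K0 D\<^esub>) xs \<one>\<^bsub>K0 D\<^esub> \<otimes>\<^bsub>K0 D\<^esub> a \<and>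
      foldr (\<otimes>\<^bsub>K0 D\<^esub>) xs \<one>\<^bsub>K0 D\<^esub> \<in> carrier (K0 D)"
    if "set xs \<subseteq> carrier (K0 D)" "a \<in> carrier (K0 D)" for xs a
    using that by (induction xs) (auto simp: G.m_assoc)
  have ts: "set (map fst ts) \<subseteq> carrier (K0 D)" using hn_typed_entries[OF snoc(1)] by auto
  have A: "fst t = k0_class D A" "k0_class D A \<in> carrier (K0 D)"
    using hn_factor_phase[OF snoc(3)] k0_class_closed by auto
  have "foldr (\<otimes>\<^bsub>K0 D\<^esub>) (map fst (ts @ [t])) \<one>\<^bsub>K0 D\<^esub> = foldr (\<otimes>\<^bsub>K0 D\<^esub>) (map fst ts) (k0_class D A)"
    using A by simp
  also have "\<dots> = k0_class D E \<otimes>\<^bsub>K0 D\<^esub> k0_class D A" using fold[OF ts A(2)] snoc(4) by simp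
  also have "\<dots> = k0_class D M" using k0_class_triangle[OF snoc(2)] by simp
  finally show ?case .
qed

text \<open>The first \<open>k\<close> factors give the type of the \<open>k\<close>-th stage of the filtration.\<close>

lemma HN_filtration_typed:
  assumes "HN_filtration D P M n E A \<phi>"
  shows "\<exists>ts. hn_typed D P ts M \<and> decreasing Z ts \<and> ts \<noteq> [] \<and> phi_of Z (last ts) = \<phi> n"
proof -
  have n: "1 \<le> n" and E: "zero_object D (E 0)" "E n = M"
    and A: "\<And>i. i \<in> {1..n} \<Longrightarrow>
      (\<exists>u v w. (E (i - 1), E i, A i, u, v, w) \<in> tri D) \<and> \<not> zero_object D (A i) \<and> A i \<in> P (\<phi> i)"
    and dec: "\<And>i j. i \<in> {1..n} \<Longrightarrow> j \<in> {1..n} \<Longrightarrow> i < j \<Longrightarrow> \<phi> i > \<phi> j"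
    using assms unfolding HN_filtration_def by blast+
  obtain win where win: "\<And>p. p \<in> phase_window (win p)" using phase_window_exists by metis
  define entry where "entry i = (k0_class D (A i), win (\<phi> i))" for i
  have fac: "hn_factor D P (entry i) (A i)" if "i \<in> {1..n}" for i
    using A[OF that] win unfolding hn_factor_def entry_def by auto
  have phi: "phi_of Z (entry i) = \<phi> i" if "i \<in> {1..n}" for i
    using semistable_phase(1)[OF _ _ win] A[OF that] unfolding entry_def by simp
  have typed: "hn_typed D P (map entry [1..<Suc k]) (E k)" if "k \<le> n" for k
    using that
  proof (induction k)
    case 0
    then show ?case using E(1) hn_typed.zero by simp
  next
    case (Suc k)
    then have k: "Suc k \<in> {1..n}" by auto
    obtain u v w where t: "(E k, E (Suc k), A (Suc k), u, v, w) \<in> tri D" using A[OF k] by auto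
    have "hn_typed D P (map entry [1..<Suc k] @ [entry (Suc k)]) (E (Suc k))"
      using hn_typed.snoc[OF _ t fac[OF k]] Suc by simp
    then show ?case by simp
  qed
  have "decreasing Z (map entry [1..<Suc n])"
    unfolding sorted_wrt_map
  proof (rule sorted_wrt_mono_rel[of _ "(<)"])
    fix i j assume "i \<in> set [1..<Suc n]" "j \<in> set [1..<Suc n]" "i < j"
    then have "i \<in> {1..n}" "j \<in> {1..n}" "i < j" by auto
    then have "phi_of Z (entry i) > phi_of Z (entry j)" using phi dec by simp
    then show "(case entry i of (\<gamma>\<^sub>1, m\<^sub>1) \<Rightarrow> \<lambda>(\<gamma>\<^sub>2, m\<^sub>2). phi_m Z m\<^sub>1 \<gamma>\<^sub>1 > phi_m Z m\<^sub>2 \<gamma>\<^sub>2) (entry j)"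
      by (simp add: case_prod_unfold)
  qed (rule sorted_wrt_upt)
  moreover have "phi_of Z (last (map entry [1..<Suc n])) = \<phi> n" using phi[of n] n by (simp add: last_map)
  ultimately show ?thesis using typed[of n] n E(2) by (intro exI[of _ "map entry [1..<Suc n]"]) auto
qed

lemma hn_type_exists:
  assumes "M \<in> ob D" "\<not> zero_object D M"
  shows "\<exists>ts. hn_typed D P ts M \<and> decreasing Z ts \<and> ts \<noteq> []"
proof -
  obtain n E A \<phi> where "HN_filtration D P M n E A \<phi>"
    using stability assms unfolding stability_condition_def by blast
  from HN_filtration_typed[OF this] show ?thesis by blast
qed

lemma phi_minus_eq:
  assumes "hn_typed D P ts M" "decreasing Z ts" "ts \<noteq> []"
  shows "phi_minus D P M = phi_of Z (last ts)"
  unfolding phi_minus_def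
proof (rule the_equality)
  have *: "p = phi_of Z (last ts)" if "\<exists>n E A \<phi>. HN_filtration D P M n E A \<phi> \<and> p = \<phi> n" for p
  proof -
    from that obtain n E A \<phi> where h: "HN_filtration D P M n E A \<phi> \<and> p = \<phi> n" by (elim exE)
    obtain ts' where "hn_typed D P ts' M" "decreasing Z ts'" "phi_of Z (last ts') = \<phi> n"
      using HN_filtration_typed h by blast
    then show ?thesis using hn_typed_unique[OF assms(1) _ assms(2)] h by metis
  qed
  obtain n E A \<phi> where h: "HN_filtration D P M n E A \<phi>"
    using stability hn_typed_nonzero[OF assms] hn_typed_ob[OF assms(1)]
    unfolding stability_condition_def by blast
  then show "\<exists>n E A \<phi>. HN_filtration D P M n E A \<phi> \<and> phi_of Z (last ts) = \<phi> n" using * by metis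
  show "p = phi_of Z (last ts)" if "\<exists>n E A \<phi>. HN_filtration D P M n E A \<phi> \<and> p = \<phi> n" for p
    using *[OF that] .
qed

lemma phi_minus_window:
  assumes "hn_typed D P ts M" "decreasing Z ts" "ts \<noteq> []"
  shows "phi_minus D P M \<in> phase_window m \<longleftrightarrow> snd (last ts) = m"
proof -
  obtain ts' t where ts: "ts = ts' @ [t]" using assms(3) by (metis rev_exhaust)
  obtain A where "hn_factor D P t A" using assms(1) hn_typed_snocE unfolding ts by metis
  then have "phi_of Z (last ts) \<in> phase_window (snd (last ts))"
    using hn_factor_phase(2) ts by simp
  then show ?thesis using phi_minus_eq[OF assms] phase_window_unique by metis
qed

end

section \<open>Isomorphism classes\<close>

lemma (in linear_category) equiv_iso_rel: "equiv (ob D) (iso_rel D)"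
proof (rule equivI)
  show "iso_rel D \<subseteq> ob D \<times> ob D" unfolding iso_rel_def by auto
  show "refl_on (ob D) (iso_rel D)" unfolding iso_rel_def refl_on_def using iso_refl by auto
  show "sym (iso_rel D)" unfolding iso_rel_def sym_def using iso_sym by blast
  show "trans (iso_rel D)" unfolding iso_rel_def trans_def using iso_trans by blast
qed

lemma (in linear_category) iso_class_eq_iff:
  "\<lbrakk>X \<in> ob D; Y \<in> ob D\<rbrakk> \<Longrightarrow> iso_class D X = iso_class D Y \<longleftrightarrow> isomorphic D X Y"
  using eq_equiv_class_iff[OF equiv_iso_rel] unfolding iso_class_def iso_rel_def by simp

lemma iso_class_in: "X \<in> ob D \<Longrightarrow> iso_class D X \<in> iso_classes D"
  unfolding iso_class_def iso_classes_def by (rule quotientI)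

lemma (in linear_category) iso_rep:
  assumes "C \<in> iso_classes D"
  shows "iso_rep C \<in> ob D" "iso_class D (iso_rep C) = C"
proof -
  obtain X where X: "X \<in> ob D" "C = iso_class D X"
    using assms unfolding iso_classes_def iso_class_def by (rule quotientE)
  have "X \<in> C" using X iso_refl unfolding iso_class_def iso_rel_def by auto
  then have "iso_rep C \<in> C" unfolding iso_rep_def by (rule someI)
  then have r: "iso_rep C \<in> ob D" "isomorphic D X (iso_rep C)"
    using X unfolding iso_class_def iso_rel_def by auto
  show "iso_rep C \<in> ob D" by (rule r(1))
  show "iso_class D (iso_rep C) = C" using iso_class_eq_iff[OF X(1) r(1)] r(2) X(2) by simp
qed

lemma (in linear_category) iso_rep_iso_class:
  assumes "X \<in> ob D"
  shows "isomorphic D (iso_rep (iso_class D X)) X"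
  using iso_rep[OF iso_class_in[OF assms]] iso_class_eq_iff[OF _ assms] by blast

text \<open>Characteristic functions of isomorphism-invariant properties can be evaluated at the chosen
  representatives.\<close>

lemma (in linear_category) indicator_iso_classes:
  assumes C: "C \<in> iso_classes D"
    and inv: "\<And>M N. \<lbrakk>M \<in> ob D; N \<in> ob D; isomorphic D M N; Q M\<rbrakk> \<Longrightarrow> Q N"
  shows "indicator {iso_class D M | M. M \<in> ob D \<and> Q M} C = (of_bool (Q (iso_rep C)) :: rat)"
proof -
  note r = iso_rep[OF C]
  have "C \<in> {iso_class D M | M. M \<in> ob D \<and> Q M} \<longleftrightarrow> Q (iso_rep C)"
  proof
    assume "C \<in> {iso_class D M | M. M \<in> ob D \<and> Q M}"
    then obtain M where M: "M \<in> ob D" "Q M" "C = iso_class D M" by blast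
    then have "isomorphic D M (iso_rep C)" using iso_class_eq_iff[OF M(1) r(1)] r(2) by simp
    then show "Q (iso_rep C)" using inv[OF M(1) r(1)] M(2) by blast
  next
    assume "Q (iso_rep C)"
    then show "C \<in> {iso_class D M | M. M \<in> ob D \<and> Q M}" using r by blast
  qed
  then show ?thesis unfolding indicator_def by simp
qed

section \<open>Products of the functions of semistable classes\<close>

text \<open>Both the Hall product and the sum over all types reduce to this situation: every term is \<open>0\<close> or
  \<open>1\<close>, and uniqueness of filtrations allows only one \<open>1\<close>.\<close>

lemma sum_support_of_bool:
  assumes h: "\<And>p. p \<in> A \<Longrightarrow> h p = (of_bool (S p) :: rat)"
    and unique: "\<And>p q. \<lbrakk>p \<in> A; q \<in> A; S p; S q\<rbrakk> \<Longrightarrow> p = q"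
  shows "finite {p \<in> A. h p \<noteq> 0}" "(\<Sum>p\<in>{p \<in> A. h p \<noteq> 0}. h p) = of_bool (\<exists>p\<in>A. S p)"
proof -
  have supp: "{p \<in> A. h p \<noteq> 0} = {p \<in> A. S p}" using h by auto
  have "finite {p \<in> A. h p \<noteq> 0} \<and> (\<Sum>p\<in>{p \<in> A. h p \<noteq> 0}. h p) = of_bool (\<exists>p\<in>A. S p)"
  proof (cases "\<exists>p\<in>A. S p")
    case True
    then obtain p where p: "p \<in> A" "S p" by blast
    then have single: "{p \<in> A. S p} = {p}" using unique by blast
    show ?thesis unfolding supp single using True h[OF p(1)] p(2) by simp
  next
    case False
    then have empty: "{p \<in> A. S p} = {}" by blast
    show ?thesis unfolding supp empty using False by simp
  qed
  then show "finite {p \<in> A. h p \<noteq> 0}" "(\<Sum>p\<in>{p \<in> A. h p \<noteq> 0}. h p) = of_bool (\<exists>p\<in>A. S p)"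
    by blast+
qed

lemma hall_prod_snoc: "fs \<noteq> [] \<Longrightarrow> hall_prod D (fs @ [f]) = hall_mult D (hall_prod D fs) f"
  unfolding hall_prod_def by simp

lemma hall_prod_defined_snoc:
  assumes "fs \<noteq> []" "hall_prod_defined D fs" "hall_mult_defined D (hall_prod D fs) f"
  shows "hall_prod_defined D (fs @ [f])"
  unfolding hall_prod_defined_def
proof (intro allI impI)
  fix i assume i: "0 < i \<and> i < length (fs @ [f])"
  show "hall_mult_defined D (hall_prod D (take i (fs @ [f]))) ((fs @ [f]) ! i)"
  proof (cases "i < length fs")
    case True
    then show ?thesis using assms(2) i unfolding hall_prod_defined_def by (simp add: nth_append)
  next
    case False
    then have "i = length fs" using i by simp
    then show ?thesis using assms(3) by simp
  qed
qed

locale finite_stability_category = stability_category K D Z P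
  for K :: "('k, 'r) ring_scheme" and D :: "('o, 'm, 'k, 'z) tricat_scheme" and Z P +
  assumes finite_field: "finite (carrier K)" and lhf: "left_homologically_finite K D"
begin

lemma delta_m_eq:
  assumes "C \<in> iso_classes D"
  shows "delta_m D P m \<gamma> C = of_bool (hn_factor D P (\<gamma>, m) (iso_rep C))"
proof -
  have "{iso_class D M | M. semistable D P M \<and> k0_class D M = \<gamma> \<and> phase P M \<in> phase_window m} =
      {iso_class D M | M. M \<in> ob D \<and> hn_factor D P (\<gamma>, m) M}"
  proof -
    have "semistable D P M \<and> k0_class D M = \<gamma> \<and> phase P M \<in> phase_window m \<longleftrightarrow>
        M \<in> ob D \<and> hn_factor D P (\<gamma>, m) M" for M
      unfolding semistable_def hn_factor_def using phase_eq by auto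
    then show ?thesis by simp
  qed
  then show ?thesis
    unfolding delta_m_def using indicator_iso_classes[OF assms, of "hn_factor D P (\<gamma>, m)"] hn_factor_iso
    by simp
qed

definition hn_step :: "(('o \<Rightarrow>\<^sub>0 int) set \<times> int) list \<Rightarrow> ('o \<Rightarrow>\<^sub>0 int) set \<times> int \<Rightarrow>
    'o \<Rightarrow> 'o set \<times> 'o set \<Rightarrow> bool" where
  "hn_step ts t L p \<longleftrightarrow> hn_typed D P ts (iso_rep (fst p)) \<and> hn_factor D P t (iso_rep (snd p)) \<and>
     (\<exists>u v w. (iso_rep (fst p), L, iso_rep (snd p), u, v, w) \<in> tri D)"

lemma hn_step_unique:
  assumes "\<forall>s\<in>set ts. phi_of Z s > phi_of Z t"
    and p: "p \<in> iso_classes D \<times> iso_classes D" "hn_step ts t L p"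
    and q: "q \<in> iso_classes D \<times> iso_classes D" "hn_step ts t L q"
  shows "p = q"
proof -
  have pc: "fst p \<in> iso_classes D" "snd p \<in> iso_classes D"
    and qc: "fst q \<in> iso_classes D" "snd q \<in> iso_classes D" using p(1) q(1) by auto
  note rp = iso_rep[OF pc(1)] iso_rep[OF pc(2)] and rq = iso_rep[OF qc(1)] iso_rep[OF qc(2)]
  obtain u v w where h: "hn_typed D P ts (iso_rep (fst p))"
      "(iso_rep (fst p), L, iso_rep (snd p), u, v, w) \<in> tri D" "hn_factor D P t (iso_rep (snd p))"
    using p(2) unfolding hn_step_def by blast
  obtain u' v' w' where h': "hn_typed D P ts (iso_rep (fst q))"
      "(iso_rep (fst q), L, iso_rep (snd q), u', v', w') \<in> tri D" "hn_factor D P t (iso_rep (snd q))"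
    using q(2) unfolding hn_step_def by blast
  note un = hn_last_step_unique[OF h assms(1) h' assms(1)]
  have "fst p = fst q" using iso_class_eq_iff[OF rp(1) rq(1)] un(2) rp(2) rq(2) by simp
  moreover have "snd p = snd q" using iso_class_eq_iff[OF rp(3) rq(3)] un(3) rp(4) rq(4) by simp
  ultimately show ?thesis by (rule prod_eqI)
qed

text \<open>Both outer terms of a triangle can be moved to the representatives of their isomorphism classes.\<close>

lemma hn_step_exists_iff:
  "(\<exists>p\<in>iso_classes D \<times> iso_classes D. hn_step ts t L p) \<longleftrightarrow> hn_typed D P (ts @ [t]) L"
proof
  assume "\<exists>p\<in>iso_classes D \<times> iso_classes D. hn_step ts t L p"
  then show "hn_typed D P (ts @ [t]) L"
    unfolding hn_step_def by (blast intro: hn_typed.snoc)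
next
  assume "hn_typed D P (ts @ [t]) L"
  then obtain E A u v w where h: "hn_typed D P ts E" "(E, L, A, u, v, w) \<in> tri D" "hn_factor D P t A"
    by (rule hn_typed_snocE)
  note o = triangle_obs[OF h(2)]
  let ?E = "iso_class D E" and ?A = "iso_class D A"
  have c: "?E \<in> iso_classes D" "?A \<in> iso_classes D" 
    by (rule iso_class_in[OF o(1)], rule iso_class_in[OF o(3)])
  note rE = iso_rep(1)[OF c(1)] and rA = iso_rep(1)[OF c(2)]
  note iE = iso_sym[OF iso_rep_iso_class[OF o(1)]] and iA = iso_sym[OF iso_rep_iso_class[OF o(3)]]
  obtain u' w' where t1: "(iso_rep ?E, L, A, u', v, w') \<in> tri D"
    using triangle_transport_first[OF h(2) rE iE] by blast
  obtain a where a: "is_iso D A (iso_rep ?A) a" using iA unfolding isomorphic_def by blast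
  obtain v'' w'' where "(iso_rep ?E, L, iso_rep ?A, u', v'', w'') \<in> tri D"
    using triangle_transport_third[OF t1 rA a] by blast
  then have "hn_step ts t L (?E, ?A)"
    unfolding hn_step_def using hn_typed_iso[OF h(1) rE iE] hn_factor_iso[OF h(3) rA iA] by auto
  then show "\<exists>p\<in>iso_classes D \<times> iso_classes D. hn_step ts t L p" using c by blast
qed

text \<open>Decreasing phases leave no maps from any \<open>M[i]\<close> to \<open>N\<close>, so the structure constant only records
  whether a triangle exists.\<close>

lemma hall_term_hn_step:
  assumes f: "\<And>C. C \<in> iso_classes D \<Longrightarrow> f C = of_bool (hn_typed D P ts (iso_rep C))"
    and ts: "\<forall>s\<in>set ts. phi_of Z s > phi_of Z t"
    and p: "p \<in> iso_classes D \<times> iso_classes D"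
  shows "hall_term D f (delta_m D P (snd t) (fst t)) L p = of_bool (hn_step ts t (iso_rep L) p)"
proof -
  obtain M N where MN: "p = (M, N)" by (cases p)
  have M: "M \<in> iso_classes D" and N: "N \<in> iso_classes D" using p MN by auto
  have d: "delta_m D P (snd t) (fst t) N = of_bool (hn_factor D P t (iso_rep N))"
    using delta_m_eq[OF N] by simp
  show ?thesis
  proof (cases "hn_typed D P ts (iso_rep M) \<and> hn_factor D P t (iso_rep N)")
    case True
    then have "no_maps D (shfn D i (iso_rep M)) (iso_rep N)" for i
      using hn_typed_no_maps[OF _ ts] hn_factor_phase(1) by blast
    from hall_number_eq[OF finite_field lhf iso_rep(1)[OF M] iso_rep(1)[OF N] this]
    show ?thesis using True unfolding hall_term_def hn_step_def MN by (simp add: f[OF M] d)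
  next
    case False
    then show ?thesis unfolding hall_term_def hn_step_def MN by (auto simp: f[OF M] d)
  qed
qed

text \<open>A quotient of \<open>M\<close> by a zero object is isomorphic to \<open>M\<close>.\<close>

lemma hn_typed_single_iff:
  assumes M: "M \<in> ob D"
  shows "hn_typed D P [t] M \<longleftrightarrow> hn_factor D P t M"
proof
  assume "hn_typed D P [t] M"
  then have "hn_typed D P ([] @ [t]) M" by simp
  then obtain E A u v w where h: "hn_typed D P [] E" "(E, M, A, u, v, w) \<in> tri D" "hn_factor D P t A"
    by (rule hn_typed_snocE)
  note o = triangle_obs[OF h(2)]
  have E: "zero_object D E" using h(1) by (simp only: hn_typed_Nil_iff)
  obtain u' where t: "(E, M, M, u', ide D M, \<zero>\<^bsub>Hom D M (shf D E)\<^esub>) \<in> tri D"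
    using unrotate_triangle[OF tri_ide[OF M shf_zero_object[OF E]] o(1)] by blast
  note zM = no_maps_zero_object[OF E M] no_maps_zero_object[OF shf_zero_object[OF E] M]
    and zA = no_maps_zero_object[OF E o(3)] no_maps_zero_object[OF shf_zero_object[OF E] o(3)]
  have "isomorphic D M A"
    using triangle_comparison[OF t h(2) zM zA zM zA] unfolding isomorphic_def by blast
  then show "hn_factor D P t M" using hn_factor_iso[OF h(3) M iso_sym] by blast
next
  assume f: "hn_factor D P t M"
  obtain T where T: "zero_object D T" using zero_object_exists by blast
  then have o: "T \<in> ob D" by (simp add: zero_object_def)
  obtain u where "(T, M, M, u, ide D M, \<zero>\<^bsub>Hom D M (shf D T)\<^esub>) \<in> tri D"
    using unrotate_triangle[OF tri_ide[OF M shf_zero_object[OF T]] o] by blast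
  from hn_typed.snoc[OF hn_typed.zero[OF T] this f] show "hn_typed D P [t] M" by simp
qed

text \<open>Appending an entry multiplies on the right by the function of a semistable class whose phase lies below
  all the others.  The term
  of the Hall product at \<open>(M, N)\<close> is then \<open>1\<close> if \<open>(M, N)\<close> is the last step of a filtration
  of \<open>L\<close> of the extended type, and this step is unique up to isomorphism.\<close>

lemma hall_prod_delta_list:
  assumes "ts \<noteq> []" "decreasing Z ts"
  shows "hall_prod_defined D (delta_list D P ts) \<and>
    (\<forall>L\<in>iso_classes D. hall_prod D (delta_list D P ts) L = of_bool (hn_typed D P ts (iso_rep L)))"
  using assms
proof (induction ts rule: rev_nonempty_induct)
  case (single t)
  have "hall_prod D (delta_list D P [t]) L = of_bool (hn_typed D P [t] (iso_rep L))"
    if "L \<in> iso_classes D" for L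
    using delta_m_eq[OF that] hn_typed_single_iff[OF iso_rep(1)[OF that]]
    unfolding hall_prod_def delta_list_def by (simp add: case_prod_unfold)
  moreover have "hall_prod_defined D (delta_list D P [t])"
    unfolding hall_prod_defined_def delta_list_def by simp
  ultimately show ?case by blast
next
  case (snoc t ts)
  have dec: "decreasing Z ts" and last: "\<forall>s\<in>set ts. phi_of Z s > phi_of Z t"
    using snoc.prems unfolding decreasing_snoc by blast+
  let ?f = "hall_prod D (delta_list D P ts)" and ?g = "delta_m D P (snd t) (fst t)"
  have IH: "hall_prod_defined D (delta_list D P ts)"
      "\<And>L. L \<in> iso_classes D \<Longrightarrow> ?f L = of_bool (hn_typed D P ts (iso_rep L))"
    using snoc.IH[OF dec] by blast+
  have list: "delta_list D P (ts @ [t]) = delta_list D P ts @ [?g]"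
    unfolding delta_list_def by (simp add: case_prod_unfold)
  have ne: "delta_list D P ts \<noteq> []" using snoc.hyps unfolding delta_list_def by simp
  have support: "hall_support D ?f ?g L = {p \<in> iso_classes D \<times> iso_classes D. hall_term D ?f ?g L p \<noteq> 0}" for L
    by (rule hall_support_def)
  let ?S = "\<lambda>L. hn_step ts t (iso_rep L)"
  have h: "hall_term D ?f ?g L p = of_bool (?S L p)" if "p \<in> iso_classes D \<times> iso_classes D" for L p
    using hall_term_hn_step[OF IH(2) last that] .
  have un: "p = q" if "p \<in> iso_classes D \<times> iso_classes D" "q \<in> iso_classes D \<times> iso_classes D"
      "?S L p" "?S L q" for L p q
    using hn_step_unique[OF last that(1,3,2,4)] .
  have "finite (hall_support D ?f ?g L)" for L
    unfolding support
    by (rule sum_support_of_bool(1)[where S = "?S L"]) (rule h, assumption, rule un, assumption+)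
  then have "hall_mult_defined D ?f ?g" unfolding hall_mult_defined_def by blast
  moreover have "hall_mult D ?f ?g L = of_bool (hn_typed D P (ts @ [t]) (iso_rep L))" for L
    unfolding hall_mult_def support hn_step_exists_iff[symmetric]
    by (rule sum_support_of_bool(2)[where S = "?S L"]) (rule h, assumption, rule un, assumption+)
  ultimately show ?case
    unfolding list hall_prod_snoc[OF ne] using hall_prod_defined_snoc[OF ne IH(1)] by blast
qed

section \<open>Sums over all types\<close>

lemma hn_types_decreasing: "ts \<in> hn_types D Z \<gamma> \<Longrightarrow> ts \<noteq> [] \<and> decreasing Z ts"
  unfolding hn_types_def by simp

lemma hn_typed_in_hn_types:
  assumes "hn_typed D P ts M" "decreasing Z ts" "ts \<noteq> []"
  shows "ts \<in> hn_types D Z \<gamma> \<longleftrightarrow> k0_class D M = \<gamma>"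
  using assms hn_typed_entries[OF assms(1)] hn_typed_k0_class[OF assms(1)]
  unfolding hn_types_def by simp

text \<open>At most one term of the sum at \<open>L\<close> is nonzero, namely the one indexed by the type of \<open>L\<close>.\<close>

lemma has_finite_sum_hn_types:
  assumes L: "L \<in> iso_classes D" and A: "A \<subseteq> hn_types D Z \<gamma>"
  shows "has_finite_sum (\<lambda>ts. hall_prod D (delta_list D P ts) L) A
    (of_bool (\<exists>ts\<in>A. hn_typed D P ts (iso_rep L)))"
  unfolding has_finite_sum_def
proof (intro conjI)
  have h: "hall_prod D (delta_list D P ts) L = of_bool (hn_typed D P ts (iso_rep L))" if "ts \<in> A" for ts
    using hall_prod_delta_list hn_types_decreasing L A that by blast
  have un: "ts = ts'" if "ts \<in> A" "ts' \<in> A" "hn_typed D P ts (iso_rep L)" "hn_typed D P ts' (iso_rep L)" for ts ts'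
    using hn_typed_unique[OF that(3,4)] hn_types_decreasing A that(1,2) by blast
  let ?S = "\<lambda>ts. hn_typed D P ts (iso_rep L)"
  show "finite {ts \<in> A. hall_prod D (delta_list D P ts) L \<noteq> 0}"
    by (rule sum_support_of_bool(1)[where S = ?S]) (rule h, assumption, rule un, assumption+)
  show "(\<Sum>ts\<in>{ts \<in> A. hall_prod D (delta_list D P ts) L \<noteq> 0}. hall_prod D (delta_list D P ts) L) =
      of_bool (\<exists>ts\<in>A. hn_typed D P ts (iso_rep L))"
    by (rule sum_support_of_bool(2)[where S = ?S]) (rule h, assumption, rule un, assumption+)
qed

lemma kappa_eq:
  assumes L: "L \<in> iso_classes D"
  shows "kappa D \<gamma> L = of_bool (\<exists>ts\<in>hn_types D Z \<gamma>. hn_typed D P ts (iso_rep L))"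
proof -
  let ?Q = "\<lambda>M. \<not> zero_object D M \<and> k0_class D M = \<gamma>"
  have inv: "?Q N" if "M \<in> ob D" "N \<in> ob D" "isomorphic D M N" "?Q M" for M N
    using that zero_object_iso[OF _ that(1) iso_sym[OF that(3)]] k0_class_iso[OF that(1-3)] by auto
  have "kappa D \<gamma> L = of_bool (?Q (iso_rep L))"
    unfolding kappa_def using indicator_iso_classes[OF L, of ?Q] inv by blast
  moreover have "?Q (iso_rep L) \<longleftrightarrow> (\<exists>ts\<in>hn_types D Z \<gamma>. hn_typed D P ts (iso_rep L))"
  proof
    assume Q: "?Q (iso_rep L)"
    then obtain ts where ts: "hn_typed D P ts (iso_rep L)" "decreasing Z ts" "ts \<noteq> []"
      using hn_type_exists iso_rep(1)[OF L] by blast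
    then show "\<exists>ts\<in>hn_types D Z \<gamma>. hn_typed D P ts (iso_rep L)"
      using hn_typed_in_hn_types[OF ts, of \<gamma>] Q by blast
  next
    assume "\<exists>ts\<in>hn_types D Z \<gamma>. hn_typed D P ts (iso_rep L)"
    then obtain ts where ts: "ts \<in> hn_types D Z \<gamma>" "hn_typed D P ts (iso_rep L)" by blast
    then show "?Q (iso_rep L)"
      using hn_types_decreasing[OF ts(1)] hn_typed_nonzero[OF ts(2)] hn_typed_in_hn_types[OF ts(2), of \<gamma>]
      by blast
  qed
  ultimately show ?thesis by simp
qed

lemma kappa_m_eq:
  assumes L: "L \<in> iso_classes D"
  shows "kappa_m D P m \<gamma> L =
    of_bool (\<exists>ts\<in>{ts \<in> hn_types D Z \<gamma>. snd (last ts) = m}. hn_typed D P ts (iso_rep L))"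
proof -
  let ?Q = "\<lambda>M. \<exists>ts\<in>{ts \<in> hn_types D Z \<gamma>. snd (last ts) = m}. hn_typed D P ts M"
  have Q: "\<not> zero_object D M \<and> k0_class D M = \<gamma> \<and> phi_minus D P M \<in> phase_window m \<longleftrightarrow> ?Q M"
    if M: "M \<in> ob D" for M
  proof
    assume h: "\<not> zero_object D M \<and> k0_class D M = \<gamma> \<and> phi_minus D P M \<in> phase_window m"
    then obtain ts where ts: "hn_typed D P ts M" "decreasing Z ts" "ts \<noteq> []"
      using hn_type_exists[OF M] by blast
    then show "?Q M" using hn_typed_in_hn_types[OF ts, of \<gamma>] phi_minus_window[OF ts, of m] h by blast
  next
    assume "?Q M"
    then obtain ts where ts: "ts \<in> hn_types D Z \<gamma>" "snd (last ts) = m" "hn_typed D P ts M" by blast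
    have d: "decreasing Z ts" "ts \<noteq> []" using hn_types_decreasing[OF ts(1)] by auto
    show "\<not> zero_object D M \<and> k0_class D M = \<gamma> \<and> phi_minus D P M \<in> phase_window m"
      using hn_typed_nonzero[OF ts(3) d] hn_typed_in_hn_types[OF ts(3) d, of \<gamma>]
        phi_minus_window[OF ts(3) d, of m] ts(1,2) by blast
  qed
  have "{iso_class D M | M. M \<in> ob D \<and> \<not> zero_object D M \<and> k0_class D M = \<gamma> \<and>
      phi_minus D P M \<in> phase_window m} = {iso_class D M | M. M \<in> ob D \<and> ?Q M}"
    using Q by blast
  moreover have "?Q N" if "M \<in> ob D" "N \<in> ob D" "isomorphic D M N" "?Q M" for M N
    using that(4) hn_typed_iso[OF _ that(2,3)] by blast
  ultimately show ?thesis
    unfolding kappa_m_def using indicator_iso_classes[OF L, of ?Q] by simp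
qed

end

section \<open>The Harder-Narasimhan identities\<close>

theorem proposition4p15:
  fixes K :: "('k, 'r) ring_scheme"
    and D :: "('o, 'm, 'k, 'z) tricat_scheme"
    and Z :: "('o \<Rightarrow>\<^sub>0 int) set \<Rightarrow> complex"
    and P :: "real \<Rightarrow> 'o set"
    and \<gamma> :: "('o \<Rightarrow>\<^sub>0 int) set"
  assumes "triangulated_category K D"
    and "finite (carrier K)"
    and "krull_schmidt D"
    and "left_homologically_finite K D"
    and "stability_condition D Z P"
    and "\<gamma> \<in> carrier (K0 D)"
  shows "(\<forall>ts\<in>hn_types D Z \<gamma>. hall_prod_defined D (delta_list D P ts)) \<and>
    (\<forall>L\<in>iso_classes D.
        has_finite_sum (\<lambda>ts. hall_prod D (delta_list D P ts) L) (hn_types D Z \<gamma>) (kappa D \<gamma> L)) \<and>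
    (\<forall>m. \<forall>L\<in>iso_classes D.
        has_finite_sum (\<lambda>ts. hall_prod D (delta_list D P ts) L)
          {ts \<in> hn_types D Z \<gamma>. snd (last ts) = m} (kappa_m D P m \<gamma> L))"
proof -
  interpret T: triangulated_category K D by (rule assms(1))
  interpret S: finite_stability_category K D Z P
    by unfold_locales (use assms in auto)
  have "hall_prod_defined D (delta_list D P ts)" if "ts \<in> hn_types D Z \<gamma>" for ts
    using S.hall_prod_delta_list S.hn_types_decreasing[OF that] by blast
  moreover have "has_finite_sum (\<lambda>ts. hall_prod D (delta_list D P ts) L) (hn_types D Z \<gamma>) (kappa D \<gamma> L)"
    if "L \<in> iso_classes D" for L
    using S.has_finite_sum_hn_types[OF that subset_refl] S.kappa_eq[OF that] by simp
  moreover have "has_finite_sum (\<lambda>ts. hall_prod D (delta_list D P ts) L)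
      {ts \<in> hn_types D Z \<gamma>. snd (last ts) = m} (kappa_m D P m \<gamma> L)"
    if "L \<in> iso_classes D" for L m
    using S.has_finite_sum_hn_types[OF that Collect_subset] S.kappa_m_eq[OF that] by simp
  ultimately show ?thesis by blast
qed

end
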